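(* Let $\mathbb{P}_{\mathsf{aux}}$ be the transition kernel of the PoissonMH algorithm with proposal $q$, hyperparameter $\lambda>0$, bounds $M_1,\dots,M_N>0$ and $L=\sum_{i=1}^N M_i$, and let $\mathbb{P}_{\mathsf{ideal}}$ be the transition kernel of the standard Metropolis–Hastings algorithm with the same proposal $q$ and the same target $\pi(\theta\mid x)$. Then $$\mathsf{Gap}(\mathbb{P}_{\mathsf{aux}})\ \ge\ \max\left\{\tfrac12\exp\left(-\frac{L^2}{\lambda+L}\right),\ e^{-1/e}\exp\left(-\frac{L^2}{2\lambda}\right)\right\}\,\mathsf{Gap}(\mathbb{P}_{\mathsf{ideal}}).$$
   Context: Setting. $\Theta$ is a measurable space with a base measure; the target is the probability distribution $\Pi$ on $\Theta$ with density $\pi(\theta\mid x)\propto\exp\{\sum_{i=1}^N\phi_i(\theta;x)\}$ ($x$ is fixed data), where for every $\theta$ and each $i$, $\phi_i(\theta;x)\in[0,M_i]$ with $M_i>0$. $q(\theta,\cdot)$ is the density (w.r.t. the base measure) of a Markov proposal kernel on $\Theta$. PoissonMH. From current state $\theta$: propose $\theta'\sim q(\theta,\cdot)$; independently sample $s_i\sim\mathrm{Poisson}\bigl(\frac{\lambda M_i}{L}+\phi_i(\theta;x)\bigr)$, $i=1,\dots,N$, mutually independent; let $S=\{i:s_i>0\}$ and $$r=\frac{\exp\{\sum_{i\in S}s_i\log(1+\frac{L}{\lambda M_i}\phi_i(\theta';x))\}}{\exp\{\sum_{i\in S}s_i\log(1+\frac{L}{\lambda M_i}\phi_i(\theta;x))\}}\cdot\frac{q(\theta',\theta)}{q(\theta,\theta')};$$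 with probability $\min\{1,r\}$ move to $\theta'$, otherwise stay at $\theta$. Idealized chain $\mathbb{P}_{\mathsf{ideal}}$. From $\theta$: propose $\theta'\sim q(\theta,\cdot)$ and accept with probability $\min\bigl\{1,\frac{\pi(\theta'\mid x)q(\theta',\theta)}{\pi(\theta\mid x)q(\theta,\theta')}\bigr\}$, otherwise stay. Both chains are reversible with respect to $\Pi$. Spectral gap. For a Markov kernel $P$ with stationary distribution $\Pi$, $L^2_0(\Pi)=\{f:\int f^2\,d\Pi<\infty,\ \int f\,d\Pi=0\}$ with norm $\lVert f\rVert_\Pi=(\int f^2 d\Pi)^{1/2}$, $(Pf)(\theta)=\int P(\theta,d\theta')f(\theta')$, $\lVert P\rVert_{L^2_0(\Pi)}=\sup\{\lVert Pf\rVert_\Pi: f\in L^2_0(\Pi),\lVert f\rVert_\Pi=1\}$, and $\mathsf{Gap}(P):=1-\lVert P\rVert_{L^2_0(\Pi)}$. *)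

theory Defs
  imports "HOL-Probability.Probability"
begin

definition target_density :: "'a measure \<Rightarrow> nat \<Rightarrow> (nat \<Rightarrow> 'a \<Rightarrow> real) \<Rightarrow> 'a \<Rightarrow> real" where
  "target_density \<mu> N \<phi> \<theta> =
     exp (\<Sum>i=1..N. \<phi> i \<theta>) / (\<integral>\<theta>'. exp (\<Sum>i=1..N. \<phi> i \<theta>') \<partial>\<mu>)"

(* This is a probability measure iff 0 < Z < infinity for the normalising constant Z: if the
   unnormalised density is not integrable, then Z = 0 and the density below vanishes. *)
definition target :: "'a measure \<Rightarrow> nat \<Rightarrow> (nat \<Rightarrow> 'a \<Rightarrow> real) \<Rightarrow> 'a measure" where
  "target \<mu> N \<phi> = density \<mu> (\<lambda>\<theta>. ennreal (target_density \<mu> N \<phi> \<theta>))"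

(* One step of a chain: draw \<theta>' from the proposal q(\<theta>, \<cdot>), toss a coin with law "acc \<theta> \<theta>'",
   move to \<theta>' on success and stay at \<theta> otherwise.  In the acceptance ratios below the
   convention x / 0 = 0 is harmless, since proposals with q(\<theta>, \<theta>') = 0 have probability 0. *)
definition propose_accept ::
    "'a measure \<Rightarrow> ('a \<Rightarrow> 'a \<Rightarrow> real) \<Rightarrow> ('a \<Rightarrow> 'a \<Rightarrow> bool pmf) \<Rightarrow> 'a \<Rightarrow> 'a measure" where
  "propose_accept \<mu> q acc \<theta> =
     density \<mu> (\<lambda>\<theta>'. ennreal (q \<theta> \<theta>')) \<bind> (\<lambda>\<theta>'.
       measure_pmf (acc \<theta> \<theta>') \<bind> (\<lambda>b. return \<mu> (if b then \<theta>' else \<theta>)))"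

definition mh_kernel ::
    "'a measure \<Rightarrow> ('a \<Rightarrow> 'a \<Rightarrow> real) \<Rightarrow> ('a \<Rightarrow> real) \<Rightarrow> 'a \<Rightarrow> 'a measure" where
  "mh_kernel \<mu> q p = propose_accept \<mu> q
     (\<lambda>\<theta> \<theta>'. bernoulli_pmf (min 1 ((p \<theta>' * q \<theta>' \<theta>) / (p \<theta> * q \<theta> \<theta>'))))"

definition poisson_mh_ratio ::
    "('a \<Rightarrow> 'a \<Rightarrow> real) \<Rightarrow> nat \<Rightarrow> (nat \<Rightarrow> 'a \<Rightarrow> real) \<Rightarrow> (nat \<Rightarrow> real) \<Rightarrow> real \<Rightarrow> real \<Rightarrow>
     'a \<Rightarrow> 'a \<Rightarrow> (nat \<Rightarrow> nat) \<Rightarrow> real" where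
  "poisson_mh_ratio q N \<phi> M L l \<theta> \<theta>' s =
     (let S = {i\<in>{1..N}. s i > 0} in
      exp (\<Sum>i\<in>S. real (s i) * ln (1 + L / (l * M i) * \<phi> i \<theta>')) /
      exp (\<Sum>i\<in>S. real (s i) * ln (1 + L / (l * M i) * \<phi> i \<theta>)) *
      (q \<theta>' \<theta> / q \<theta> \<theta>'))"

definition poisson_mh_kernel ::
    "'a measure \<Rightarrow> ('a \<Rightarrow> 'a \<Rightarrow> real) \<Rightarrow> nat \<Rightarrow> (nat \<Rightarrow> 'a \<Rightarrow> real) \<Rightarrow> (nat \<Rightarrow> real) \<Rightarrow> real \<Rightarrow> real \<Rightarrow>
     'a \<Rightarrow> 'a measure" where
  "poisson_mh_kernel \<mu> q N \<phi> M L l = propose_accept \<mu> q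
     (\<lambda>\<theta> \<theta>'. bind_pmf (Pi_pmf {1..N} 0 (\<lambda>i. poisson_pmf (l * M i / L + \<phi> i \<theta>)))
        (\<lambda>s. bernoulli_pmf (min 1 (poisson_mh_ratio q N \<phi> M L l \<theta> \<theta>' s))))"

definition L2_zero_mean :: "'a measure \<Rightarrow> ('a \<Rightarrow> real) set" where
  "L2_zero_mean P =
     {f \<in> borel_measurable P. integrable P (\<lambda>\<theta>. (f \<theta>)\<^sup>2) \<and> (\<integral>\<theta>. f \<theta> \<partial>P) = 0}"

definition L2_fun_norm :: "'a measure \<Rightarrow> ('a \<Rightarrow> real) \<Rightarrow> real" where
  "L2_fun_norm P f = sqrt (\<integral>\<theta>. (f \<theta>)\<^sup>2 \<partial>P)"

definition kernel_op :: "('a \<Rightarrow> 'a measure) \<Rightarrow> ('a \<Rightarrow> real) \<Rightarrow> 'a \<Rightarrow> real" where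
  "kernel_op K f \<theta> = (\<integral>\<theta>'. f \<theta>' \<partial>(K \<theta>))"

(* Inserting 0 only matters when there is no f with norm 1, i.e. when the space is trivial: the
   operator norm is then 0, whereas Sup {} is unspecified on the reals. *)
definition kernel_norm :: "'a measure \<Rightarrow> ('a \<Rightarrow> 'a measure) \<Rightarrow> real" where
  "kernel_norm P K = Sup (insert 0
     {L2_fun_norm P (kernel_op K f) | f. f \<in> L2_zero_mean P \<and> L2_fun_norm P f = 1})"

definition spectral_gap :: "'a measure \<Rightarrow> ('a \<Rightarrow> 'a measure) \<Rightarrow> real" where
  "spectral_gap P K = 1 - kernel_norm P K"

end

theory Submission imports Defs begin

text \<open>For a propose-accept chain reversible with respect to a density \<open>p\<close>, write
  \<open>\<langle>P f, g\<rangle> = \<langle>f, g\<rangle> - 1/2 \<integral>\<integral> w(x,y) (f x - f y) (g x - g y)\<close> with \<open>w(x,y) = p(x) q(x,y) a(x,y)\<close>, where \<open>a\<close>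
  is the mean acceptance probability. For PoissonMH, with \<open>P\<^sub>x\<close> the law of \<open>s\<close> given \<open>x\<close>,
  \<open>w(x,y) = \<Sum>s. min (p(x) q(x,y) P\<^sub>x(s)) (p(y) q(y,x) P\<^sub>y(s))\<close>, which lies between
  \<open>c \<cdot> min (p(x) q(x,y)) (p(y) q(y,x))\<close> and \<open>min (p(x) q(x,y)) (p(y) q(y,x))\<close>
  if \<open>c\<close> is a lower bound for the overlaps \<open>\<Sum>s. min P\<^sub>x(s) P\<^sub>y(s)\<close>. The lower bound on the flow controls
  the top of the spectrum. The upper bound shows that the bottom of the spectrum of the auxiliary chain
  is no lower than that of the ideal chain; since the gap is absolute, both are needed.
  The overlap is at least \<open>B\<^sup>2/2\<close> for the Hellinger affinity \<open>B\<close> and at least \<open>exp (- KL - 1/e)\<close>; both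
  \<open>B\<close> and \<open>KL\<close> are explicit for products of Poisson laws.\<close>

section \<open>Overlap of probability mass functions\<close>

text \<open>Passing to counting measure puts expectations under two laws on one measure space, where
  their mass functions can be compared pointwise.\<close>

lemma expectation_pmf_count_space:
  fixes h :: "'b \<Rightarrow> real"
  shows "measure_pmf.expectation D h = (\<integral>s. pmf D s * h s \<partial>count_space UNIV)"
    and "integrable (measure_pmf D) h \<longleftrightarrow> integrable (count_space UNIV) (\<lambda>s. pmf D s * h s)"
  unfolding measure_pmf_eq_density
  by (simp_all add: integral_density integrable_density)

section \<open>Exponential moments and mean of a Poisson law\<close>

lemma poisson_expectation_sums:
  fixes h :: "nat \<Rightarrow> real"
  assumes "a > 0" "\<And>k. h k \<ge> 0" "(\<lambda>k. a ^ k / fact k * exp (- a) * h k) sums v"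
  shows "has_bochner_integral (measure_pmf (poisson_pmf a)) h v"
proof -
  have "\<And>k. \<bar>a ^ k / fact k * exp (- a) * h k\<bar> = a ^ k / fact k * exp (- a) * h k"
    using assms(1,2) by (intro abs_of_nonneg) simp
  then have "integrable (count_space UNIV) (\<lambda>k. a ^ k / fact k * exp (- a) * h k)"
    using assms by (simp add: integrable_count_space_nat_iff sums_iff)
  then show ?thesis
    using assms sums_unique[OF assms(3)]
    by (auto simp: has_bochner_integral_iff expectation_pmf_count_space less_imp_le integral_count_space_nat)
qed

lemma poisson_mgf:
  fixes a c :: real
  assumes "a > 0"
  shows "has_bochner_integral (measure_pmf (poisson_pmf a)) (\<lambda>k. exp (real k * c)) (exp (a * exp c - a))"
proof (rule poisson_expectation_sums)
  have "(\<lambda>k. exp (- a) * ((a * exp c) ^ k / fact k)) sums (exp (- a) * exp (a * exp c))"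
    using exp_converges[of "a * exp c"] by (intro sums_mult) (simp add: divide_inverse_commute)
  also have "(\<lambda>k. exp (- a) * ((a * exp c) ^ k / fact k)) = (\<lambda>k. a ^ k / fact k * exp (- a) * exp (real k * c))"
    by (rule ext, subst exp_of_nat_mult) (simp add: power_mult_distrib)
  also have "exp (- a) * exp (a * exp c) = exp (a * exp c - a)"
    by (simp flip: exp_add)
  finally show "(\<lambda>k. a ^ k / fact k * exp (- a) * exp (real k * c)) sums exp (a * exp c - a)" .
qed (use assms in auto)

lemma poisson_mean:
  fixes a :: real
  assumes "a > 0"
  shows "has_bochner_integral (measure_pmf (poisson_pmf a)) real a"
proof (rule poisson_expectation_sums)
  have "(\<lambda>k. (a * exp (- a)) * (a ^ k / fact k)) sums (a * exp (- a) * exp a)"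
    using exp_converges[of a] by (intro sums_mult) (simp add: divide_inverse_commute)
  \<comment> \<open>The factor \<open>real (Suc k)\<close> cancels against
    \<open>fact (Suc k)\<close>; the term at index 0 vanishes, so the shifted sum suffices.\<close>
  also have "(\<lambda>k. (a * exp (- a)) * (a ^ k / fact k)) =
      (\<lambda>k. a ^ Suc k / fact (Suc k) * exp (- a) * real (Suc k))"
    by (rule ext) (simp add: fact_Suc del: of_nat_Suc)
  also have "a * exp (- a) * exp a = a" by (simp add: exp_minus)
  finally show "(\<lambda>k. a ^ k / fact k * exp (- a) * real k) sums a"
    by (subst (asm) sums_Suc_iff) simp
qed (use assms in auto)

section \<open>Lower bounds on the overlap from the log-likelihood ratio\<close>

lemma expectation_exp_likelihood:
  assumes "\<And>s. pmf D' s = pmf D s * exp (g s)"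
  shows "has_bochner_integral (measure_pmf D) (\<lambda>s. exp (g s)) 1"
proof -
  have "has_bochner_integral (count_space UNIV) (pmf D') 1"
    using integrable_pmf[of UNIV D'] by (simp add: has_bochner_integral_iff integral_pmf)
  then show ?thesis
    unfolding has_bochner_integral_iff expectation_pmf_count_space by (simp flip: assms)
qed

text \<open>Le Cam's inequality between affinity and overlap: the maximum of the two mass functions
  has total at most 2, which is where the factor 1/2 comes from.\<close>

lemma half_affinity_square_le_overlap:
  assumes "\<And>s. pmf D' s = pmf D s * exp (g s)"
    and B: "has_bochner_integral (measure_pmf D) (\<lambda>s. exp (g s / 2)) B" "B > 0"
  shows "B\<^sup>2 / 2 \<le> measure_pmf.expectation D (\<lambda>s. min 1 (exp (g s)))"
proof -
  note I = expectation_exp_likelihood[OF assms(1)]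
  have Im: "integrable (measure_pmf D) (\<lambda>s. min 1 (exp (g s)))"
    by (rule measure_pmf.integrable_const_bound[where B = 1]) auto
  \<comment> \<open>\<open>exp (g / 2) = sqrt (min 1 (exp g) * max 1 (exp g))\<close>, then AM-GM with weight \<open>2 / B\<close>\<close>
  have "exp (g s / 2) \<le> min 1 (exp (g s)) / B + (1 + exp (g s)) * B / 4" for s
  proof -
    define u where "u = exp (g s / 2)"
    have u: "u > 0" "exp (g s) = u\<^sup>2"
      by (auto simp: u_def simp flip: exp_double)
    \<comment> \<open>\<open>m\<close> stands for \<open>min 1 (u\<^sup>2)\<close>. After
      multiplication by \<open>B\<close>, each case says that a sum of two squares is
      nonnegative.\<close>
    have "u \<le> m / B + (1 + u\<^sup>2) * B / 4" if "m = 1 \<and> u \<ge> 1 \<or> m = u\<^sup>2 \<and> u \<le> 1" for m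
      using that
    proof (elim disjE conjE)
      assume "m = 1" "u \<ge> 1"
      have "0 \<le> (1 - u * B / 2)\<^sup>2 + B\<^sup>2 / 4" by simp
      then show ?thesis using \<open>m = 1\<close> B(2) by (simp add: field_simps power2_eq_square)
    next
      assume "m = u\<^sup>2" "u \<le> 1"
      have "0 \<le> (u - B / 2)\<^sup>2 + u\<^sup>2 * B\<^sup>2 / 4" by simp
      then show ?thesis using \<open>m = u\<^sup>2\<close> B(2) by (simp add: field_simps power2_eq_square)
    qed
    moreover have "min 1 (u\<^sup>2) = 1 \<and> u \<ge> 1 \<or> min 1 (u\<^sup>2) = u\<^sup>2 \<and> u \<le> 1"
      using u(1) power_le_one[of u 2] one_le_power[of u 2] by (cases "u \<ge> 1") (auto simp: min_def)
    ultimately show ?thesis unfolding u(2) u_def[symmetric] by blast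
  qed
  then have "B \<le> measure_pmf.expectation D (\<lambda>s. min 1 (exp (g s)) / B + (1 + exp (g s)) * B / 4)"
    unfolding has_bochner_integral_integral_eq[OF B(1), symmetric]
    using B(1) I Im by (intro integral_mono) (auto simp: has_bochner_integral_iff)
  also have "\<dots> = measure_pmf.expectation D (\<lambda>s. min 1 (exp (g s))) / B + B / 2"
    using I Im by (simp add: has_bochner_integral_iff)
  finally show ?thesis
    using B(2) by (simp add: field_simps power2_eq_square)
qed

text \<open>Jensen's inequality for the negative part of \<open>g\<close>. Here \<open>- v\<close>
  is the Kullback-Leibler divergence of \<open>D\<close> from \<open>D'\<close>, and the positive
  part of \<open>g\<close> costs at most \<open>1 / exp 1\<close> because \<open>exp g\<close> has
  mean 1.\<close>

lemma exp_neg_divergence_le_overlap: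
  assumes "\<And>s. pmf D' s = pmf D s * exp (g s)"
    and v: "has_bochner_integral (measure_pmf D) g v"
  shows "exp (v - 1 / exp 1) \<le> measure_pmf.expectation D (\<lambda>s. min 1 (exp (g s)))"
proof -
  note I = expectation_exp_likelihood[OF assms(1)]
  have Im: "integrable (measure_pmf D) (\<lambda>s. min 1 (exp (g s)))"
    by (rule measure_pmf.integrable_const_bound[where B = 1]) auto
  \<comment> \<open>The tangent point is the mean of \<open>g s - exp (g s) / exp 1\<close>, so the
    linear term integrates to zero.\<close>
  define c where "c = v - 1 / exp 1"
  \<comment> \<open>\<open>max 0 g \<le> exp g / e\<close>, and the tangent line of \<open>exp\<close> at \<open>c\<close>\<close>
  have "exp c * (1 + (g s - exp (g s) / exp 1 - c)) \<le> min 1 (exp (g s))" for s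
  proof -
    have "g s \<le> exp (g s) / exp 1"
      using exp_ge_add_one_self[of "g s - 1"] by (simp add: exp_diff)
    then have m: "g s - exp (g s) / exp 1 \<le> min 0 (g s)" by simp
    have "exp c * (1 + (g s - exp (g s) / exp 1 - c)) \<le> exp c * exp (g s - exp (g s) / exp 1 - c)"
      by (intro mult_left_mono exp_ge_add_one_self) simp
    also have "\<dots> = exp (g s - exp (g s) / exp 1)" by (simp flip: exp_add)
    also have "\<dots> \<le> exp (min 0 (g s))" using m by simp
    finally show ?thesis by (auto simp: min_def split: if_splits)
  qed
  then have "measure_pmf.expectation D (\<lambda>s. exp c * (1 + (g s - exp (g s) / exp 1 - c)))
      \<le> measure_pmf.expectation D (\<lambda>s. min 1 (exp (g s)))"
    using I v Im by (intro integral_mono) (auto simp: has_bochner_integral_iff)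
  also have "measure_pmf.expectation D (\<lambda>s. exp c * (1 + (g s - exp (g s) / exp 1 - c))) = exp c"
    using I v by (simp add: has_bochner_integral_iff c_def)
  finally show ?thesis unfolding c_def .
qed

section \<open>Mean acceptance as a weighted overlap\<close>

text \<open>The right side is invariant under exchanging the pair of \<open>\<alpha>\<close> and
  \<open>D\<close> with the pair of \<open>\<beta>\<close> and \<open>D'\<close>, which yields
  detailed balance. With both weights 1 it is the overlap.\<close>

lemma expectation_min_symmetric:
  assumes "\<And>s. pmf D' s = pmf D s * exp (g s)" "\<alpha> \<ge> 0" "\<beta> \<ge> 0"
  shows "\<alpha> * measure_pmf.expectation D (\<lambda>s. min 1 (exp (g s) * (\<beta> / \<alpha>)))
     = (\<integral>s. min (\<alpha> * pmf D s) (\<beta> * pmf D' s) \<partial>count_space UNIV)"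
proof -
  have "\<alpha> * (pmf D s * min 1 (exp (g s) * (\<beta> / \<alpha>))) = min (\<alpha> * pmf D s) (\<beta> * pmf D' s)" for s
  proof (cases "\<alpha> = 0")
    case False
    then have "\<alpha> > 0" using assms(2) by simp
    then have "\<alpha> * min 1 (exp (g s) * (\<beta> / \<alpha>)) = min \<alpha> (\<beta> * exp (g s))"
      by (auto simp: min_def field_simps)
    then have "\<alpha> * (pmf D s * min 1 (exp (g s) * (\<beta> / \<alpha>))) = pmf D s * min \<alpha> (\<beta> * exp (g s))"
      by (simp only: mult.left_commute[of \<alpha>])
    then show ?thesis
      using min_mult_distrib_left[of "pmf D s" \<alpha> "\<beta> * exp (g s)"]
      by (simp add: assms(1) mult.left_commute[of "pmf D s"] mult.commute[of "pmf D s" \<alpha>])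
  \<comment> \<open>For \<open>\<alpha> = 0\<close> both sides vanish, whatever value the division
    takes.\<close>
  qed (use assms in \<open>simp add: min_def\<close>)
  then show ?thesis
    unfolding expectation_pmf_count_space by (simp flip: integral_mult_right_zero)
qed

text \<open>When the weights are the proposal flows in the two directions,
  \<open>min \<alpha> \<beta>\<close> is the ideal flow and \<open>I\<close> the auxiliary one, so
  these are the two comparisons of flows.\<close>

lemma integral_min_pmf_bounds:
  fixes D D' :: "'b pmf"
  assumes "\<alpha> \<ge> 0" "\<beta> \<ge> 0"
  defines "I \<equiv> \<integral>s. min (\<alpha> * pmf D s) (\<beta> * pmf D' s) \<partial>count_space UNIV"
  shows "I \<le> min \<alpha> \<beta>"
    and "min \<alpha> \<beta> * (\<integral>s. min (pmf D s) (pmf D' s) \<partial>count_space UNIV) \<le> I"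
proof -
  have i: "integrable (count_space UNIV) (pmf E)" "(\<integral>s. pmf E s \<partial>count_space UNIV) = 1" for E :: "'b pmf"
    using integrable_pmf[of UNIV E] by (auto simp: integral_pmf)
  have im: "integrable (count_space UNIV) (\<lambda>s. min (a * pmf D s) (b * pmf D' s))" for a b
    using i by (intro integrable_min) auto
  have "I \<le> (\<integral>s. \<alpha> * pmf D s \<partial>count_space UNIV)" "I \<le> (\<integral>s. \<beta> * pmf D' s \<partial>count_space UNIV)"
    unfolding I_def by (rule integral_mono[OF im]; simp add: i)+
  then show "I \<le> min \<alpha> \<beta>" using i by simp
  have "min \<alpha> \<beta> * min (pmf D s) (pmf D' s) \<le> min (\<alpha> * pmf D s) (\<beta> * pmf D' s)" for s
    using assms by (intro min.boundedI mult_mono) auto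
  then show "min \<alpha> \<beta> * (\<integral>s. min (pmf D s) (pmf D' s) \<partial>count_space UNIV) \<le> I"
    unfolding I_def using im[of 1 1] im
    by (subst integral_mult_right_zero[symmetric], intro integral_mono) auto
qed

section \<open>Scalar inequalities for two Poisson rates\<close>

text \<open>The left side is minus the Kullback-Leibler divergence of Poisson laws with rates
  \<open>a\<close> and \<open>b\<close>. Divided by the smaller rate it depends only on a ratio
  \<open>u \<ge> 1\<close>; equality holds at 1, and a derivative of constant sign does the
  rest.\<close>

lemma poisson_divergence_bound:
  fixes a b :: real
  assumes "a > 0" "b > 0"
  shows "a * ln (b / a) + (a - b) \<ge> - ((a - b)\<^sup>2 / (2 * min a b))"
proof (cases "a \<le> b")
  case True
  define u where "u = b / a"
  have u: "u \<ge> 1" "b = a * u" using True assms by (auto simp: u_def)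
    have "(\<lambda>t. ln t - t + 1 / 2 * (t-1)\<^sup>2) 1 \<le> (\<lambda>t. ln t - t + 1 / 2 * (t-1)\<^sup>2) u"
    proof (rule DERIV_nonneg_imp_nondecreasing[OF u(1)])
      fix x :: real assume x: "1 \<le> x" "x \<le> u"
      have "((\<lambda>t. ln t - t + 1 / 2 * (t-1)\<^sup>2) has_real_derivative (1/x - 1 + (x - 1))) (at x)"
        using x by (auto intro!: derivative_eq_intros simp: field_simps)
      moreover have "1/x - 1 + (x - 1) = (x-1)\<^sup>2 / x"
        using x by (simp add: field_simps power2_eq_square)
      ultimately show "\<exists>y. ((\<lambda>t. ln t - t + 1 / 2 * (t-1)\<^sup>2) has_real_derivative y) (at x) \<and> 0 \<le> y"
        using x by auto
    qed
  then have "- ((1 - u)\<^sup>2 / 2) \<le> ln u + (1 - u)"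
    by (simp add: power2_eq_square field_simps)
  then have "a * (- ((1 - u)\<^sup>2 / 2)) \<le> a * (ln u + (1 - u))"
    using assms by (intro mult_left_mono) auto
  moreover have "a - b = a * (1 - u)" using u(2) by (simp add: right_diff_distrib)
  moreover have "(a - b)\<^sup>2 / (2 * min a b) = a * ((1 - u)\<^sup>2 / 2)"
    unfolding \<open>a - b = a * (1 - u)\<close> using True assms by (simp add: min_def power2_eq_square)
  ultimately show ?thesis unfolding u_def[symmetric] by (simp add: distrib_left)
next
  case False
  define u where "u = a / b"
  have u: "u \<ge> 1" "a = b * u" using False assms by (auto simp: u_def)
  have "(\<lambda>t. 1 / 2 * (t-1)\<^sup>2 - t * ln t + t) 1 \<le> (\<lambda>t. 1 / 2 * (t-1)\<^sup>2 - t * ln t + t) u"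
  proof (rule DERIV_nonneg_imp_nondecreasing[OF u(1)])
    fix x :: real assume x: "1 \<le> x" "x \<le> u"
    have "((\<lambda>t. 1 / 2 * (t-1)\<^sup>2 - t * ln t + t) has_real_derivative (x - 1 - ln x)) (at x)"
      using x by (auto intro!: derivative_eq_intros)
    moreover have "ln x \<le> x - 1" using x by (intro ln_le_minus_one) auto
    ultimately show "\<exists>y. ((\<lambda>t. 1 / 2 * (t-1)\<^sup>2 - t * ln t + t) has_real_derivative y) (at x) \<and> 0 \<le> y"
      by (intro exI[of _ "x - 1 - ln x"]) auto
  qed
  then have "- ((u - 1)\<^sup>2 / 2) \<le> - (u * ln u) + (u - 1)"
    by (simp add: power2_eq_square field_simps)
  then have "b * (- ((u - 1)\<^sup>2 / 2)) \<le> b * (- (u * ln u) + (u - 1))"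
    using assms by (intro mult_left_mono) auto
  moreover have "ln (b / a) = - ln u" using assms by (simp add: u_def ln_div)
  moreover have "(a - b)\<^sup>2 / (2 * min a b) = b * ((u - 1)\<^sup>2 / 2)"
  proof -
    have "a - b = b * (u - 1)" using u(2) by (simp add: right_diff_distrib)
    then show ?thesis using False assms by (simp add: min_def power2_eq_square)
  qed
  moreover have "a * ln (b / a) + (a - b) = b * (- (u * ln u) + (u - 1))"
    unfolding \<open>ln (b / a) = - ln u\<close> using u(2) by (simp add: algebra_simps)
  ultimately show ?thesis by simp
qed

text \<open>The difference \<open>a - b\<close> factors into \<open>sqrt a - sqrt b\<close> and
  \<open>sqrt a + sqrt b\<close>, and the square of the second factor is at least
  \<open>max a b\<close>.\<close>

lemma hellinger_bound:
  fixes a b :: real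
  assumes "a > 0" "b > 0"
  shows "(sqrt a - sqrt b)\<^sup>2 \<le> (a - b)\<^sup>2 / max a b"
proof -
  have "max a b \<le> (sqrt a + sqrt b)\<^sup>2" using assms by (simp add: power2_sum)
  then have "(sqrt a - sqrt b)\<^sup>2 * max a b \<le> (sqrt a - sqrt b)\<^sup>2 * (sqrt a + sqrt b)\<^sup>2"
    by (intro mult_left_mono) auto
  also have "\<dots> = ((sqrt a)\<^sup>2 - (sqrt b)\<^sup>2)\<^sup>2"
    by (simp add: power_mult_distrib[symmetric] square_diff_square_factored[symmetric] power2_eq_square algebra_simps)
  also have "\<dots> = (a - b)\<^sup>2" using assms by simp
  finally show ?thesis using assms by (simp add: pos_le_divide_eq less_max_iff_disj)
qed

section \<open>Products of Poisson distributions\<close>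

text \<open>Logarithm of the likelihood ratio of the product law with rates \<open>b\<close> to the
  one with rates \<open>a\<close>; the factorials cancel.\<close>

definition poisson_loglik :: "'i set \<Rightarrow> ('i \<Rightarrow> real) \<Rightarrow> ('i \<Rightarrow> real) \<Rightarrow> ('i \<Rightarrow> nat) \<Rightarrow> real" where
  "poisson_loglik A a b s = (\<Sum>i\<in>A. real (s i) * ln (b i / a i) + (a i - b i))"

abbreviation poisson_product :: "'i set \<Rightarrow> ('i \<Rightarrow> real) \<Rightarrow> ('i \<Rightarrow> nat) pmf" where
  "poisson_product A a \<equiv> Pi_pmf A 0 (\<lambda>i. poisson_pmf (a i))"

context
  fixes A :: "'i set" and a b :: "'i \<Rightarrow> real"
  assumes fin: "finite A" and pos: "\<And>i. i \<in> A \<Longrightarrow> a i > 0" "\<And>i. i \<in> A \<Longrightarrow> b i > 0"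
begin

lemma pmf_poisson_product:
  "pmf (poisson_product A b) s = pmf (poisson_product A a) s * exp (poisson_loglik A a b s)"
proof -
  have "b i ^ k / fact k * exp (- b i) =
      (a i ^ k / fact k * exp (- a i)) * exp (real k * ln (b i / a i) + (a i - b i))"
    if "i \<in> A" for i k
  proof -
    have "exp (real k * ln (b i / a i) + (a i - b i)) = (b i / a i) ^ k * (exp (a i) * exp (- b i))"
      using pos[OF that] by (simp add: exp_add exp_of_nat_mult exp_diff exp_minus divide_inverse)
    then show ?thesis
      using pos[OF that] by (simp add: power_divide exp_minus)
  qed
  then have "(\<Prod>i\<in>A. b i ^ s i / fact (s i) * exp (- b i)) =
      (\<Prod>i\<in>A. a i ^ s i / fact (s i) * exp (- a i)) * exp (poisson_loglik A a b s)"
    unfolding poisson_loglik_def exp_sum[OF fin] prod.distrib[symmetric] by (intro prod.cong) auto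
  moreover have "(\<Prod>i\<in>A. pmf (poisson_pmf (c i)) (s i)) = (\<Prod>i\<in>A. c i ^ s i / fact (s i) * exp (- c i))"
    if "\<And>i. i \<in> A \<Longrightarrow> c i > 0" for c
    using that by (intro prod.cong) (auto intro!: pmf_poisson less_imp_le)
  \<comment> \<open>Off the support, where some \<open>s i\<close> with \<open>i\<close> outside
    \<open>A\<close> is nonzero, both mass functions are 0; on it the product formula
    applies.\<close>
  moreover define P where "P \<longleftrightarrow> (\<forall>i. i \<notin> A \<longrightarrow> s i = 0)"
  ultimately show ?thesis
    using pos unfolding pmf_Pi[OF fin] P_def[symmetric] by (cases P) simp_all
qed

text \<open>The log-likelihood ratio is affine in \<open>s\<close>, so only coordinate means enter.
  The value is minus the Kullback-Leibler divergence of the products.\<close>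

lemma expectation_poisson_loglik:
  "has_bochner_integral (measure_pmf (poisson_product A a)) (poisson_loglik A a b)
     (\<Sum>i\<in>A. a i * ln (b i / a i) + (a i - b i))"
  unfolding poisson_loglik_def
proof (intro has_bochner_integral_sum has_bochner_integral_add has_bochner_integral_mult_left)
  fix i assume i: "i \<in> A"
  have "has_bochner_integral (map_pmf (\<lambda>s. s i) (poisson_product A a)) real (a i)"
    unfolding Pi_pmf_component[OF fin] using i pos(1)[OF i] poisson_mean[of "a i"] by simp
  then show "has_bochner_integral (measure_pmf (poisson_product A a)) (\<lambda>s. real (s i)) (a i)"
    by (simp add: has_bochner_integral_iff)
  show "has_bochner_integral (measure_pmf (poisson_product A a)) (\<lambda>s. a i - b i) (a i - b i)"
    by (simp add: has_bochner_integral_iff)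
qed

text \<open>The square root of the likelihood ratio is a product over coordinates. Each factor is an
  exponential moment of one Poisson law at \<open>ln (b i / a i) / 2\<close>, and independence
  multiplies them.\<close>

lemma expectation_poisson_affinity:
  "has_bochner_integral (measure_pmf (poisson_product A a)) (\<lambda>s. exp (poisson_loglik A a b s / 2))
     (exp (- (\<Sum>i\<in>A. (sqrt (a i) - sqrt (b i))\<^sup>2) / 2))"
proof -
  define h where "h i k = exp (real k * (ln (b i / a i) / 2)) * exp ((a i - b i) / 2)" for i and k :: nat
  have h: "has_bochner_integral (measure_pmf (poisson_pmf (a i))) (h i)
      (exp (- ((sqrt (a i) - sqrt (b i))\<^sup>2 / 2)))" if "i \<in> A" for i
  proof -
    have "exp (ln (b i / a i) / 2) = sqrt (b i / a i)"
      using pos[OF that] by (simp add: exp_ln_iff ln_sqrt[symmetric])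
    then have "a i * exp (ln (b i / a i) / 2) = sqrt (a i) * sqrt (b i)"
      using pos[OF that] by (simp add: real_sqrt_divide real_div_sqrt flip: times_divide_eq_left)
    then have "a i * exp (ln (b i / a i) / 2) - a i + (a i - b i) / 2 = - ((sqrt (a i) - sqrt (b i))\<^sup>2 / 2)"
      using pos[OF that] by (simp add: power2_diff field_simps)
    then have "exp (a i * exp (ln (b i / a i) / 2) - a i) * exp ((a i - b i) / 2)
        = exp (- ((sqrt (a i) - sqrt (b i))\<^sup>2 / 2))"
      by (simp only: exp_add[symmetric])
    with has_bochner_integral_mult_left[OF poisson_mgf[OF pos(1)[OF that], of "ln (b i / a i) / 2"],
        of "exp ((a i - b i) / 2)"]
    show ?thesis unfolding h_def by simp
  qed
  have eq: "exp (poisson_loglik A a b s / 2) = (\<Prod>i\<in>A. h i (s i))" for s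
    unfolding h_def poisson_loglik_def sum_divide_distrib exp_sum[OF fin]
    by (simp add: add_divide_distrib flip: exp_add)
  have "measure_pmf.expectation (poisson_product A a) (\<lambda>s. \<Prod>i\<in>A. h i (s i)) =
      (\<Prod>i\<in>A. exp (- ((sqrt (a i) - sqrt (b i))\<^sup>2 / 2)))"
    using h by (subst expectation_prod_Pi_pmf[OF fin]) (auto simp: has_bochner_integral_iff h_def)
  also have "\<dots> = exp (- (\<Sum>i\<in>A. (sqrt (a i) - sqrt (b i))\<^sup>2) / 2)"
    by (simp add: exp_sum[OF fin, symmetric] sum_negf sum_divide_distrib)
  moreover have "integrable (measure_pmf (poisson_product A a)) (\<lambda>s. \<Prod>i\<in>A. h i (s i))"
    using h by (intro integrable_prod_Pi_pmf[OF fin]) (auto simp: has_bochner_integral_iff)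
  ultimately show ?thesis by (simp add: eq has_bochner_integral_iff)
qed

text \<open>Both rates of coordinate \<open>i\<close> lie in a window of length \<open>M i\<close>
  above \<open>l * M i / L\<close>. The first bound comes from the affinity, the second from the
  divergence; each coordinate costs at most a fixed multiple of \<open>M i\<close>, and the
  \<open>M i\<close> sum to \<open>L\<close>.\<close>

lemma poisson_overlap_bound:
  fixes l :: real and M :: "'i \<Rightarrow> real"
  assumes l: "l > 0" and M: "\<And>i. i \<in> A \<Longrightarrow> M i > 0" and "A \<noteq> {}"
    and L: "L = sum M A"
    and ab: "\<And>i. i \<in> A \<Longrightarrow> a i \<in> {l * M i / L..l * M i / L + M i}"
      "\<And>i. i \<in> A \<Longrightarrow> b i \<in> {l * M i / L..l * M i / L + M i}"
  shows "max (1 / 2 * exp (- (L\<^sup>2 / (l + L)))) (exp (- (1 / exp 1)) * exp (- (L\<^sup>2 / (2 * l))))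
    \<le> measure_pmf.expectation (poisson_product A a) (\<lambda>s. min 1 (exp (poisson_loglik A a b s)))"
    (is "max ?c1 ?c2 \<le> ?o")
proof (rule max.boundedI)
  have Lp: "L > 0" unfolding L by (rule sum_pos) (use fin \<open>A \<noteq> {}\<close> M in auto)
  have d: "\<bar>a i - b i\<bar> \<le> M i" if "i \<in> A" for i
    using ab[OF that] by auto
  have "(sqrt (a i) - sqrt (b i))\<^sup>2 \<le> M i * (L / (l + L))" if "i \<in> A" for i
  proof -
    define d where "d = \<bar>a i - b i\<bar>"
    define c where "c = l * M i / L"
    have c: "c > 0" unfolding c_def using l M[OF that] Lp by simp
    \<comment> \<open>The smaller rate is at least \<open>c\<close>, and the larger one exceeds it
      by \<open>d\<close>.\<close>
    have m: "0 \<le> d" "d \<le> M i" "c + d \<le> max (a i) (b i)"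
      using ab[OF that] d[OF that] by (auto simp: d_def c_def)
    have "(sqrt (a i) - sqrt (b i))\<^sup>2 \<le> (a i - b i)\<^sup>2 / max (a i) (b i)"
      by (rule hellinger_bound[OF pos[OF that]])
    also have "\<dots> = d\<^sup>2 / max (a i) (b i)" by (simp add: d_def)
    also have "\<dots> \<le> d\<^sup>2 / (c + d)" using m c by (intro divide_left_mono mult_pos_pos) auto
    also have "\<dots> \<le> (M i)\<^sup>2 / (c + M i)"
    proof -
      \<comment> \<open>\<open>d\<^sup>2 / (c + d)\<close> increases with \<open>d\<close>: the
        cross-multiplied difference is \<open>M i - d\<close> times a sum of nonnegative
        terms.\<close>
      have "d * (M i - d) * c + d * M i * (M i - d) + M i * c * (M i - d) \<ge> 0"
        using m c M[OF that] by (intro add_nonneg_nonneg mult_nonneg_nonneg) auto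
      then have "d\<^sup>2 * (c + M i) \<le> (M i)\<^sup>2 * (c + d)"
        by (simp add: algebra_simps power2_eq_square)
      moreover have "c + d > 0" "c + M i > 0" using m c by auto
      ultimately show ?thesis
        by (simp only: pos_divide_le_eq times_divide_eq_left pos_le_divide_eq)
    qed
    also have "\<dots> = M i * (L / (l + L))"
    proof -
      have "c + M i = M i * ((l + L) / L)" using Lp by (simp add: c_def field_simps)
      then show ?thesis using M[OF that] by (simp add: power2_eq_square)
    qed
    finally show ?thesis .
  qed
  then have "(\<Sum>i\<in>A. (sqrt (a i) - sqrt (b i))\<^sup>2) \<le> (\<Sum>i\<in>A. M i * (L / (l + L)))"
    by (rule sum_mono)
  also have "\<dots> = L\<^sup>2 / (l + L)"
    unfolding sum_distrib_right[symmetric] L[symmetric] by (simp add: power2_eq_square)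
  finally have "?c1 \<le> 1 / 2 * exp (- (\<Sum>i\<in>A. (sqrt (a i) - sqrt (b i))\<^sup>2))" by simp
  also have "\<dots> = (exp (- (\<Sum>i\<in>A. (sqrt (a i) - sqrt (b i))\<^sup>2) / 2))\<^sup>2 / 2"
    by (simp flip: exp_double)
  also have "\<dots> \<le> ?o"
    by (rule half_affinity_square_le_overlap[OF pmf_poisson_product expectation_poisson_affinity]) simp
  finally show "?c1 \<le> ?o" .

  have "- (M i * (L / (2 * l))) \<le> a i * ln (b i / a i) + (a i - b i)" if "i \<in> A" for i
  proof -
    \<comment> \<open>The denominator now holds the smaller rate, bounded by the left end of the
      window; the affinity had the larger one. Hence \<open>l\<close> in place of
      \<open>l + L\<close>.\<close>
    have "(a i - b i)\<^sup>2 / (2 * min (a i) (b i)) \<le> (M i)\<^sup>2 / (2 * (l * M i / L))"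
      using power_mono[OF d[OF that], of 2] ab[OF that] l M[OF that] Lp by (intro frac_le) auto
    also have "\<dots> = M i * (L / (2 * l))" using M[OF that] by (simp add: power2_eq_square)
    finally show ?thesis using poisson_divergence_bound[OF pos[OF that]] by simp
  qed
  then have "(\<Sum>i\<in>A. - (M i * (L / (2 * l)))) \<le> (\<Sum>i\<in>A. a i * ln (b i / a i) + (a i - b i))"
    by (rule sum_mono)
  moreover have "(\<Sum>i\<in>A. - (M i * (L / (2 * l)))) = - (L\<^sup>2 / (2 * l))"
    unfolding sum_negf sum_distrib_right[symmetric] L[symmetric] by (simp add: power2_eq_square)
  ultimately have "?c2 \<le> exp ((\<Sum>i\<in>A. a i * ln (b i / a i) + (a i - b i)) - 1 / exp 1)"
    by (simp flip: exp_add)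
  also have "\<dots> \<le> ?o"
    by (rule exp_neg_divergence_le_overlap[OF pmf_poisson_product expectation_poisson_loglik])
  finally show "?c2 \<le> ?o" .
qed

end

section \<open>Reversible propose-accept kernels\<close>

text \<open>Common setting of both chains, which share \<open>\<mu>\<close>, \<open>p\<close> and
  \<open>q\<close> and differ only in the coin. The coin acts only through its success probability,
  so detailed balance is stated for that. Positivity of \<open>p\<close> lets null sets pass from
  the stationary law to \<open>\<mu>\<close>.\<close>

locale accept_kernel =
  fixes \<mu> :: "'a measure" and p :: "'a \<Rightarrow> real" and q :: "'a \<Rightarrow> 'a \<Rightarrow> real" and acc :: "'a \<Rightarrow> 'a \<Rightarrow> bool pmf"
  assumes base_sigma_finite: "sigma_finite_measure \<mu>"
    and p_measurable[measurable]: "p \<in> borel_measurable \<mu>"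
    and p_pos: "\<And>x. x \<in> space \<mu> \<Longrightarrow> p x > 0"
    and prob: "prob_space (density \<mu> p)"
    and q_measurable[measurable]: "case_prod q \<in> borel_measurable (\<mu> \<Otimes>\<^sub>M \<mu>)"
    and q_nonneg: "\<And>x y. x \<in> space \<mu> \<Longrightarrow> y \<in> space \<mu> \<Longrightarrow> q x y \<ge> 0"
    and q_prob: "\<And>x. x \<in> space \<mu> \<Longrightarrow> (\<integral>\<^sup>+y. q x y \<partial>\<mu>) = 1"
    and acc_measurable: "(\<lambda>(x, y). pmf (acc x y) True) \<in> borel_measurable (\<mu> \<Otimes>\<^sub>M \<mu>)"
    and reversible: "\<And>x y. x \<in> space \<mu> \<Longrightarrow> y \<in> space \<mu> \<Longrightarrow>
      p x * q x y * pmf (acc x y) True = p y * q y x * pmf (acc y x) True"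
begin

sublocale pair_sigma_finite \<mu> \<mu>
  using base_sigma_finite by (simp add: pair_sigma_finite_def)

abbreviation stat :: "'a measure" where "stat \<equiv> density \<mu> p"
abbreviation kern :: "'a \<Rightarrow> 'a measure" where "kern \<equiv> propose_accept \<mu> q acc"

definition rate :: "'a \<Rightarrow> 'a \<Rightarrow> real" where "rate x y = pmf (acc x y) True"
text \<open>Density of the mass carried by accepted moves from \<open>x\<close> to \<open>y\<close>
  in stationarity; the atom left by rejections is excluded.\<close>

definition flow :: "'a \<Rightarrow> 'a \<Rightarrow> real" where "flow x y = p x * q x y * rate x y"

lemma rate_measurable[measurable]: "case_prod rate \<in> borel_measurable (\<mu> \<Otimes>\<^sub>M \<mu>)"
  using acc_measurable by (simp add: rate_def[abs_def])

lemma rate_bounds: "0 \<le> rate x y" "rate x y \<le> 1"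
  by (auto simp: rate_def pmf_le_1)

lemma flow_measurable[measurable]: "case_prod flow \<in> borel_measurable (\<mu> \<Otimes>\<^sub>M \<mu>)"
  unfolding flow_def[abs_def] by measurable

lemma flow_nonneg: "x \<in> space \<mu> \<Longrightarrow> y \<in> space \<mu> \<Longrightarrow> flow x y \<ge> 0"
  using p_pos q_nonneg by (simp add: flow_def rate_bounds less_imp_le)

lemma flow_symmetric: "x \<in> space \<mu> \<Longrightarrow> y \<in> space \<mu> \<Longrightarrow> flow x y = flow y x"
  using reversible by (simp add: flow_def rate_def)

section \<open>One step as a measure: measurability, integrals and total mass\<close>

lemma coin_measurable:
  assumes "x \<in> space \<mu>" "y \<in> space \<mu>"
  shows "(\<lambda>b. return \<mu> (if b then y else x)) \<in> measurable (measure_pmf D) (subprob_algebra \<mu>)"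
  using assms by (auto simp: space_subprob_algebra intro!: prob_space_imp_subprob_space prob_space_return)

lemma sets_coin:
  "sets (measure_pmf D \<bind> (\<lambda>b. return \<mu> (if b then y else x))) = sets \<mu>"
  by (rule sets_bind) auto

lemma nn_integral_coin:
  assumes [measurable]: "f \<in> borel_measurable \<mu>" and xy: "x \<in> space \<mu>" "y \<in> space \<mu>"
  shows "(\<integral>\<^sup>+z. f z \<partial>(measure_pmf (acc x y) \<bind> (\<lambda>b. return \<mu> (if b then y else x))))
    = ennreal (rate x y) * f y + ennreal (1 - rate x y) * f x"
proof -
  have "(\<integral>\<^sup>+z. f z \<partial>(measure_pmf (acc x y) \<bind> (\<lambda>b. return \<mu> (if b then y else x))))
      = (\<integral>\<^sup>+b. f (if b then y else x) \<partial>measure_pmf (acc x y))"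
    using xy by (subst nn_integral_bind[OF assms(1) coin_measurable]) (auto intro!: nn_integral_cong nn_integral_return)
  also have "\<dots> = ennreal (rate x y) * f y + ennreal (1 - rate x y) * f x"
    by (simp add: nn_integral_measure_pmf nn_integral_count_space_finite UNIV_bool rate_def
        pmf_False_conv_True add.commute)
  finally show ?thesis .
qed

text \<open>The state \<open>x\<close> is fixed and only the proposal varies, as the outer bind
  requires. On each set the measure is an explicit function of \<open>y\<close>.\<close>

lemma step_measurable:
  assumes "x \<in> space \<mu>"
  shows "(\<lambda>y. measure_pmf (acc x y) \<bind> (\<lambda>b. return \<mu> (if b then y else x)))
    \<in> measurable \<mu> (subprob_algebra \<mu>)"
proof (rule measurable_subprob_algebra)
  fix y assume y: "y \<in> space \<mu>"
  show "subprob_space (measure_pmf (acc x y) \<bind> (\<lambda>b. return \<mu> (if b then y else x)))"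
    using assms y by (intro subprob_space_bind[OF _ coin_measurable]) (auto intro: measure_pmf.subprob_space_axioms)
next
  fix A assume [measurable]: "A \<in> sets \<mu>"
  have "emeasure (measure_pmf (acc x y) \<bind> (\<lambda>b. return \<mu> (if b then y else x))) A
      = ennreal (rate x y) * indicator A y + ennreal (1 - rate x y) * indicator A x" if "y \<in> space \<mu>" for y
    using nn_integral_coin[of "indicator A" x y] assms that by (simp add: sets_coin)
  moreover have "(\<lambda>y. ennreal (rate x y) * indicator A y + ennreal (1 - rate x y) * indicator A x)
      \<in> borel_measurable \<mu>"
    using assms by measurable
  ultimately show "(\<lambda>y. emeasure (measure_pmf (acc x y) \<bind> (\<lambda>b. return \<mu> (if b then y else x))) A)
      \<in> borel_measurable \<mu>"
    by (simp cong: measurable_cong)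
qed (rule sets_coin)

lemma sets_kern[simp]: "x \<in> space \<mu> \<Longrightarrow> sets (kern x) = sets \<mu>"
  unfolding propose_accept_def by (intro sets_bind) (auto simp: sets_coin)

text \<open>Explicit form that replaces the nested binds in all later integrals.\<close>

lemma nn_integral_kern:
  assumes [measurable]: "f \<in> borel_measurable \<mu>" and x: "x \<in> space \<mu>"
  shows "(\<integral>\<^sup>+z. f z \<partial>kern x) =
    (\<integral>\<^sup>+y. ennreal (q x y) * (ennreal (rate x y) * f y + ennreal (1 - rate x y) * f x) \<partial>\<mu>)"
proof -
  have [measurable]: "(\<lambda>y. q x y) \<in> borel_measurable \<mu>" "(\<lambda>y. rate x y) \<in> borel_measurable \<mu>"
    using x by measurable
  have "(\<integral>\<^sup>+z. f z \<partial>kern x) = (\<integral>\<^sup>+y. (\<integral>\<^sup>+z. f z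
      \<partial>(measure_pmf (acc x y) \<bind> (\<lambda>b. return \<mu> (if b then y else x)))) \<partial>density \<mu> (\<lambda>y. ennreal (q x y)))"
    unfolding propose_accept_def
    using step_measurable[OF x] by (intro nn_integral_bind) (auto cong: measurable_cong_sets)
  also have "\<dots> = (\<integral>\<^sup>+y. ennreal (rate x y) * f y + ennreal (1 - rate x y) * f x \<partial>density \<mu> (\<lambda>y. ennreal (q x y)))"
    using x by (intro nn_integral_cong) (simp add: nn_integral_coin)
  finally show ?thesis by (simp add: nn_integral_density)
qed

lemma prob_space_kern:
  assumes x: "x \<in> space \<mu>"
  shows "prob_space (kern x)"
proof
  have sp: "space (kern x) = space \<mu>" using sets_kern[OF x] by (rule sets_eq_imp_space_eq)
  have "emeasure (kern x) (space (kern x)) = (\<integral>\<^sup>+z. 1 \<partial>kern x)" by simp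
  also have "\<dots> = (\<integral>\<^sup>+y. ennreal (q x y) * (ennreal (rate x y) * 1 + ennreal (1 - rate x y) * 1) \<partial>\<mu>)"
    using x by (intro nn_integral_kern) auto
  also have "\<dots> = (\<integral>\<^sup>+y. q x y \<partial>\<mu>)"
    using rate_bounds by (simp flip: ennreal_plus)
  finally show "emeasure (kern x) (space (kern x)) = 1" using q_prob[OF x] by simp
qed

text \<open>The nonnegative formula is applied to the positive and negative parts of
  \<open>f\<close>, and the results are subtracted.\<close>

lemma integral_kern:
  assumes f: "integrable (kern x) f" and [measurable]: "f \<in> borel_measurable \<mu>" and x: "x \<in> space \<mu>"
  shows "has_bochner_integral \<mu> (\<lambda>y. q x y * (rate x y * f y + (1 - rate x y) * f x)) (\<integral>z. f z \<partial>kern x)"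
proof -
  have [measurable]: "(\<lambda>y. q x y) \<in> borel_measurable \<mu>" "(\<lambda>y. rate x y) \<in> borel_measurable \<mu>"
    using x by measurable
  have *: "has_bochner_integral \<mu> (\<lambda>y. q x y * (rate x y * g y + (1 - rate x y) * g x)) (\<integral>z. g z \<partial>kern x)"
    if [measurable]: "g \<in> borel_measurable \<mu>" and g: "\<And>y. g y \<ge> 0" "integrable (kern x) g" for g :: "'a \<Rightarrow> real"
  proof (rule has_bochner_integral_nn_integral)
    have "(\<integral>\<^sup>+y. ennreal (q x y * (rate x y * g y + (1 - rate x y) * g x)) \<partial>\<mu>) = (\<integral>\<^sup>+z. ennreal (g z) \<partial>kern x)"
    proof (subst nn_integral_kern[OF _ x], goal_cases)
      case 2
      have "ennreal (q x y * (rate x y * g y + (1 - rate x y) * g x))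
          = ennreal (q x y) * (ennreal (rate x y) * ennreal (g y) + ennreal (1 - rate x y) * ennreal (g x))"
        if "y \<in> space \<mu>" for y
        using q_nonneg[OF x that] by (simp add: ennreal_mult rate_bounds g)
      then show ?case by (intro nn_integral_cong) simp
    qed measurable
    also have "\<dots> = ennreal (\<integral>z. g z \<partial>kern x)"
      using g by (intro nn_integral_eq_integral) auto
    finally show "(\<integral>\<^sup>+y. ennreal (q x y * (rate x y * g y + (1 - rate x y) * g x)) \<partial>\<mu>) = ennreal (\<integral>z. g z \<partial>kern x)" .
    show "0 \<le> (\<integral>z. g z \<partial>kern x)" using g(1) by simp
    show "AE y in \<mu>. 0 \<le> q x y * (rate x y * g y + (1 - rate x y) * g x)"
      using x by (auto intro!: AE_I2 mult_nonneg_nonneg add_nonneg_nonneg simp: g rate_bounds q_nonneg)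
  qed measurable
  have i: "integrable (kern x) (\<lambda>y. max 0 (f y))" "integrable (kern x) (\<lambda>y. max 0 (- f y))"
    using f by auto
  have "has_bochner_integral \<mu>
     (\<lambda>y. q x y * (rate x y * max 0 (f y) + (1 - rate x y) * max 0 (f x)) -
          q x y * (rate x y * max 0 (- f y) + (1 - rate x y) * max 0 (- f x)))
     ((\<integral>z. max 0 (f z) \<partial>kern x) - (\<integral>z. max 0 (- f z) \<partial>kern x))"
    by (intro has_bochner_integral_diff * i) auto
  moreover have "q x y * (rate x y * max 0 (f y) + (1 - rate x y) * max 0 (f x)) -
          q x y * (rate x y * max 0 (- f y) + (1 - rate x y) * max 0 (- f x))
       = q x y * (rate x y * f y + (1 - rate x y) * f x)" for y
    by (auto simp: max_def algebra_simps)
  moreover have "(\<integral>z. max 0 (f z) \<partial>kern x) - (\<integral>z. max 0 (- f z) \<partial>kern x) = (\<integral>z. f z \<partial>kern x)"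
  proof -
    have "(\<lambda>z. max 0 (f z) - max 0 (- f z)) = f" by (auto simp: max_def)
    then show ?thesis using Bochner_Integration.integral_diff[OF i] by simp
  qed
  ultimately show ?thesis by simp
qed

section \<open>Flow and stationarity\<close>

text \<open>Only an inequality, since rejected mass is dropped: the rate is at most 1 and the
  proposal has total mass 1.\<close>

lemma nn_integral_flow_fst:
  assumes [measurable]: "g \<in> borel_measurable \<mu>"
  shows "(\<integral>\<^sup>+z. ennreal (flow (fst z) (snd z)) * g (fst z) \<partial>(\<mu> \<Otimes>\<^sub>M \<mu>)) \<le> (\<integral>\<^sup>+x. g x \<partial>stat)"
proof -
  have "(\<integral>\<^sup>+z. ennreal (flow (fst z) (snd z)) * g (fst z) \<partial>(\<mu> \<Otimes>\<^sub>M \<mu>))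
      = (\<integral>\<^sup>+x. \<integral>\<^sup>+y. ennreal (flow x y) * g x \<partial>\<mu> \<partial>\<mu>)"
    by (subst sigma_finite_measure.nn_integral_fst[OF base_sigma_finite, symmetric]) auto
  also have "\<dots> \<le> (\<integral>\<^sup>+x. ennreal (p x) * g x \<partial>\<mu>)"
  proof (rule nn_integral_mono)
    fix x assume x: "x \<in> space \<mu>"
    then have [measurable]: "(\<lambda>y. q x y) \<in> borel_measurable \<mu>" by measurable
    have "(\<integral>\<^sup>+y. ennreal (flow x y) * g x \<partial>\<mu>) \<le> (\<integral>\<^sup>+y. (ennreal (p x) * g x) * ennreal (q x y) \<partial>\<mu>)"
    proof (rule nn_integral_mono)
      fix y assume y: "y \<in> space \<mu>"
      have "flow x y \<le> p x * q x y * 1"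
        unfolding flow_def using p_pos[OF x] q_nonneg[OF x y] rate_bounds by (intro mult_left_mono) auto
      then have "ennreal (flow x y) \<le> ennreal (p x) * ennreal (q x y)"
        using p_pos[OF x] q_nonneg[OF x y] by (simp flip: ennreal_mult)
      then show "ennreal (flow x y) * g x \<le> (ennreal (p x) * g x) * ennreal (q x y)"
        using mult_right_mono[of "ennreal (flow x y)" "ennreal (p x) * ennreal (q x y)" "g x"]
        by (simp add: ac_simps)
    qed
    also have "\<dots> = ennreal (p x) * g x"
      using q_prob[OF x] by (subst nn_integral_cmult) auto
    finally show "(\<integral>\<^sup>+y. ennreal (flow x y) * g x \<partial>\<mu>) \<le> ennreal (p x) * g x" .
  qed
  also have "\<dots> = (\<integral>\<^sup>+x. g x \<partial>stat)" by (simp add: nn_integral_density)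
  finally show ?thesis .
qed

lemma nn_integral_flow_swap:
  assumes [measurable]: "g \<in> borel_measurable \<mu>"
  shows "(\<integral>\<^sup>+x. \<integral>\<^sup>+y. ennreal (flow x y) * g y \<partial>\<mu> \<partial>\<mu>) = (\<integral>\<^sup>+x. \<integral>\<^sup>+y. ennreal (flow x y) * g x \<partial>\<mu> \<partial>\<mu>)"
proof -
  have "(\<integral>\<^sup>+x. \<integral>\<^sup>+y. ennreal (flow x y) * g y \<partial>\<mu> \<partial>\<mu>) = (\<integral>\<^sup>+y. \<integral>\<^sup>+x. ennreal (flow x y) * g y \<partial>\<mu> \<partial>\<mu>)"
    by (rule Fubini'[symmetric]) measurable
  also have "\<dots> = (\<integral>\<^sup>+y. \<integral>\<^sup>+x. ennreal (flow y x) * g y \<partial>\<mu> \<partial>\<mu>)"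
    by (intro nn_integral_cong) (simp add: flow_symmetric)
  finally show ?thesis .
qed

text \<open>Stationarity. Symmetry of the flow moves \<open>f\<close> from the end of an accepted
  move to its start; accepted and rejected mass then recombine to \<open>p x\<close>.\<close>

lemma nn_integral_stat_kern:
  assumes [measurable]: "f \<in> borel_measurable \<mu>"
  shows "(\<integral>\<^sup>+x. (\<integral>\<^sup>+y. f y \<partial>kern x) \<partial>stat) = (\<integral>\<^sup>+x. f x \<partial>stat)"
proof -
  have m[measurable]: "(\<lambda>y. q x y) \<in> borel_measurable \<mu>" "(\<lambda>y. rate x y) \<in> borel_measurable \<mu>"
     "(\<lambda>y. flow x y) \<in> borel_measurable \<mu>" if "x \<in> space \<mu>" for x
    using that by measurable
  \<comment> \<open>Contribution of rejected proposals, which see \<open>f\<close> at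
    \<open>x\<close> only.\<close>
  define r where "r x y = ennreal (p x * q x y * (1 - rate x y)) * f x" for x y
  have [measurable]: "case_prod r \<in> borel_measurable (\<mu> \<Otimes>\<^sub>M \<mu>)" unfolding r_def[abs_def] by measurable
  have add: "(\<integral>\<^sup>+y. ennreal (flow x y) * u y + r x y \<partial>\<mu>)
      = (\<integral>\<^sup>+y. ennreal (flow x y) * u y \<partial>\<mu>) + (\<integral>\<^sup>+y. r x y \<partial>\<mu>)"
    if "x \<in> space \<mu>" and [measurable]: "u \<in> borel_measurable \<mu>" for x u
    using m[OF that(1)] that(1) by (intro nn_integral_add) auto
  have "(\<integral>\<^sup>+x. (\<integral>\<^sup>+y. f y \<partial>kern x) \<partial>stat) = (\<integral>\<^sup>+x. (\<integral>\<^sup>+y. ennreal (q x y) *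
      (ennreal (rate x y) * f y + ennreal (1 - rate x y) * f x) \<partial>\<mu>) \<partial>stat)"
    by (intro nn_integral_cong) (simp add: nn_integral_kern)
  also have "\<dots> = (\<integral>\<^sup>+x. ennreal (p x) * (\<integral>\<^sup>+y. ennreal (q x y) *
      (ennreal (rate x y) * f y + ennreal (1 - rate x y) * f x) \<partial>\<mu>) \<partial>\<mu>)"
    by (subst nn_integral_density) auto
  also have "\<dots> = (\<integral>\<^sup>+x. \<integral>\<^sup>+y. ennreal (flow x y) * f y + r x y \<partial>\<mu> \<partial>\<mu>)"
  proof (intro nn_integral_cong)
    fix x assume x: "x \<in> space \<mu>"
    show "ennreal (p x) * (\<integral>\<^sup>+y. ennreal (q x y) * (ennreal (rate x y) * f y + ennreal (1 - rate x y) * f x) \<partial>\<mu>)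
       = (\<integral>\<^sup>+y. ennreal (flow x y) * f y + r x y \<partial>\<mu>)"
      using x p_pos[OF x] m[OF x]
      by (subst nn_integral_cmult[symmetric])
        (auto intro!: nn_integral_cong simp: flow_def r_def ennreal_mult rate_bounds q_nonneg distrib_left mult.assoc)
  qed
  also have "\<dots> = (\<integral>\<^sup>+x. \<integral>\<^sup>+y. ennreal (flow x y) * f y \<partial>\<mu> \<partial>\<mu>) + (\<integral>\<^sup>+x. \<integral>\<^sup>+y. r x y \<partial>\<mu> \<partial>\<mu>)"
    by (simp add: add cong: nn_integral_cong) (rule nn_integral_add; measurable)
  also have "\<dots> = (\<integral>\<^sup>+x. \<integral>\<^sup>+y. ennreal (flow x y) * f x \<partial>\<mu> \<partial>\<mu>) + (\<integral>\<^sup>+x. \<integral>\<^sup>+y. r x y \<partial>\<mu> \<partial>\<mu>)"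
    by (simp add: nn_integral_flow_swap)
  also have "\<dots> = (\<integral>\<^sup>+x. \<integral>\<^sup>+y. ennreal (flow x y) * f x + r x y \<partial>\<mu> \<partial>\<mu>)"
    by (simp add: add cong: nn_integral_cong) (rule nn_integral_add[symmetric]; measurable)
  also have "\<dots> = (\<integral>\<^sup>+x. ennreal (p x) * f x \<partial>\<mu>)"
  proof (intro nn_integral_cong)
    fix x assume x: "x \<in> space \<mu>"
    have "(\<integral>\<^sup>+y. ennreal (flow x y) * f x + r x y \<partial>\<mu>) = (\<integral>\<^sup>+y. (ennreal (p x) * f x) * ennreal (q x y) \<partial>\<mu>)"
    proof (intro nn_integral_cong)
      fix y assume y: "y \<in> space \<mu>"
      have "ennreal (flow x y) + ennreal (p x * q x y * (1 - rate x y)) = ennreal (p x) * ennreal (q x y)"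
      proof -
        have "0 \<le> p x * q x y * (1 - rate x y)"
          using p_pos[OF x] q_nonneg[OF x y] rate_bounds[of x y] by simp
        then have "ennreal (flow x y) + ennreal (p x * q x y * (1 - rate x y))
            = ennreal (flow x y + p x * q x y * (1 - rate x y))"
          using flow_nonneg[OF x y] by simp
        also have "flow x y + p x * q x y * (1 - rate x y) = p x * q x y"
          by (simp add: flow_def algebra_simps)
        finally show ?thesis
          using p_pos[OF x] q_nonneg[OF x y] by (simp add: ennreal_mult)
      qed
      then show "ennreal (flow x y) * f x + r x y = (ennreal (p x) * f x) * ennreal (q x y)"
        by (simp only: r_def distrib_right[symmetric]) (simp only: ac_simps)
    qed
    also have "\<dots> = ennreal (p x) * f x"
      using q_prob[OF x] m[OF x] by (subst nn_integral_cmult) auto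
    finally show "(\<integral>\<^sup>+y. ennreal (flow x y) * f x + r x y \<partial>\<mu>) = ennreal (p x) * f x" .
  qed
  also have "\<dots> = (\<integral>\<^sup>+x. f x \<partial>stat)" by (simp add: nn_integral_density)
  finally show ?thesis .
qed

end

section \<open>Dirichlet forms\<close>

context accept_kernel begin

definition square_integrable :: "('a \<Rightarrow> real) \<Rightarrow> bool" where
  "square_integrable f \<longleftrightarrow> f \<in> borel_measurable \<mu> \<and> integrable stat (\<lambda>x. (f x)\<^sup>2)"

text \<open>The bilinear form of the identity minus the kernel. Rejections drop out because the
  differences vanish on the diagonal, so the flow alone determines it.\<close>

definition dirichlet :: "('a \<Rightarrow> real) \<Rightarrow> ('a \<Rightarrow> real) \<Rightarrow> real" where
  "dirichlet f g = (\<integral>z. flow (fst z) (snd z) * ((f (fst z) - f (snd z)) * (g (fst z) - g (snd z))) \<partial>(\<mu> \<Otimes>\<^sub>M \<mu>)) / 2"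

section \<open>Square-integrable functions and integrability against the flow\<close>

lemma square_integrable_measurable: "square_integrable f \<Longrightarrow> f \<in> borel_measurable \<mu>"
  by (simp add: square_integrable_def)

text \<open>The weight \<open>h\<close> is the constant 1 for products under \<open>stat\<close>,
  and the flow for products on the pair space.\<close>

lemma integrable_mult_of_squares:
  fixes f g :: "'b \<Rightarrow> real"
  assumes "f \<in> borel_measurable P" "g \<in> borel_measurable P" "h \<in> borel_measurable P"
    and "AE x in P. h x \<ge> 0"
    and "integrable P (\<lambda>x. h x * (f x)\<^sup>2)" "integrable P (\<lambda>x. h x * (g x)\<^sup>2)"
  shows "integrable P (\<lambda>x. h x * (f x * g x))"
proof (rule Bochner_Integration.integrable_bound)
  show "integrable P (\<lambda>x. h x * (f x)\<^sup>2 + h x * (g x)\<^sup>2)" using assms by simp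
  show "AE x in P. norm (h x * (f x * g x)) \<le> norm (h x * (f x)\<^sup>2 + h x * (g x)\<^sup>2)"
    using assms(4)
  proof eventually_elim
    case (elim x)
    have "\<bar>f x * g x\<bar> \<le> (f x)\<^sup>2 + (g x)\<^sup>2"
    proof -
      have "2 * \<bar>f x\<bar> * \<bar>g x\<bar> \<le> \<bar>f x\<bar>\<^sup>2 + \<bar>g x\<bar>\<^sup>2" by (rule sum_squares_bound)
      moreover have "0 \<le> \<bar>f x\<bar> * \<bar>g x\<bar>" by simp
      ultimately show ?thesis unfolding abs_mult power2_abs by linarith
    qed
    then have "h x * \<bar>f x * g x\<bar> \<le> h x * ((f x)\<^sup>2 + (g x)\<^sup>2)" using elim by (rule mult_left_mono)
    then show ?case using elim by (simp add: abs_mult distrib_left)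
  qed
qed (use assms in measurable)

lemma square_integrable_mult:
  assumes "square_integrable f" "square_integrable g"
  shows "integrable stat (\<lambda>x. f x * g x)"
  using integrable_mult_of_squares[of f stat g "\<lambda>_. 1"] assms by (simp add: square_integrable_def)

lemma square_integrable_const: "square_integrable (\<lambda>_. c)"
  using prob by (simp add: square_integrable_def prob_space.emeasure_space_1 finite_measure.integrable_const prob_space.finite_measure)

lemma square_integrable_linear:
  assumes "square_integrable f" "square_integrable g"
  shows "square_integrable (\<lambda>x. a * f x + b * g x)"
proof -
  have "(\<lambda>x. (a * f x + b * g x)\<^sup>2) = (\<lambda>x. a\<^sup>2 * (f x)\<^sup>2 + b\<^sup>2 * (g x)\<^sup>2 + 2 * a * b * (f x * g x))"
    by (auto simp: power2_eq_square algebra_simps)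
  then show ?thesis
    using assms square_integrable_mult[OF assms]
    by (auto simp: square_integrable_def intro!: borel_measurable_add borel_measurable_times)
qed

lemma flow_fst_integrable:
  assumes "square_integrable f"
  shows "integrable (\<mu> \<Otimes>\<^sub>M \<mu>) (\<lambda>z. flow (fst z) (snd z) * (f (fst z))\<^sup>2)"
proof (rule integrableI_nonneg)
  have [measurable]: "f \<in> borel_measurable \<mu>" using assms by (rule square_integrable_measurable)
  show "(\<lambda>z. flow (fst z) (snd z) * (f (fst z))\<^sup>2) \<in> borel_measurable (\<mu> \<Otimes>\<^sub>M \<mu>)" by measurable
  show "AE z in \<mu> \<Otimes>\<^sub>M \<mu>. 0 \<le> flow (fst z) (snd z) * (f (fst z))\<^sup>2"
    by (intro AE_I2) (auto simp: space_pair_measure flow_nonneg)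
  have "(\<integral>\<^sup>+z. ennreal (flow (fst z) (snd z) * (f (fst z))\<^sup>2) \<partial>(\<mu> \<Otimes>\<^sub>M \<mu>))
      = (\<integral>\<^sup>+z. ennreal (flow (fst z) (snd z)) * ennreal ((f (fst z))\<^sup>2) \<partial>(\<mu> \<Otimes>\<^sub>M \<mu>))"
    by (intro nn_integral_cong) (auto simp: ennreal_mult'' )
  also have "\<dots> \<le> (\<integral>\<^sup>+x. ennreal ((f x)\<^sup>2) \<partial>stat)"
    by (rule nn_integral_flow_fst) measurable
  also have "\<dots> < \<infinity>"
    using assms by (simp add: square_integrable_def integrable_iff_bounded)
  finally show "(\<integral>\<^sup>+z. ennreal (flow (fst z) (snd z) * (f (fst z))\<^sup>2) \<partial>(\<mu> \<Otimes>\<^sub>M \<mu>)) < \<infinity>" .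
qed

text \<open>Because the flow is symmetric, the product measure weighted by it is invariant under
  exchanging coordinates.\<close>

lemma flow_swap:
  fixes h :: "'a \<times> 'a \<Rightarrow> real"
  assumes [measurable]: "h \<in> borel_measurable (\<mu> \<Otimes>\<^sub>M \<mu>)"
  shows "integrable (\<mu> \<Otimes>\<^sub>M \<mu>) (\<lambda>z. flow (fst z) (snd z) * h (snd z, fst z))
      \<longleftrightarrow> integrable (\<mu> \<Otimes>\<^sub>M \<mu>) (\<lambda>z. flow (fst z) (snd z) * h z)"
    and "(\<integral>z. flow (fst z) (snd z) * h (snd z, fst z) \<partial>(\<mu> \<Otimes>\<^sub>M \<mu>))
      = (\<integral>z. flow (fst z) (snd z) * h z \<partial>(\<mu> \<Otimes>\<^sub>M \<mu>))"
proof -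
  have eq: "(\<lambda>(x, y). (\<lambda>z. flow (fst z) (snd z) * h z) (y, x)) z = flow (fst z) (snd z) * h (snd z, fst z)"
    if "z \<in> space (\<mu> \<Otimes>\<^sub>M \<mu>)" for z
    using that by (auto simp: space_pair_measure flow_symmetric)
  show "integrable (\<mu> \<Otimes>\<^sub>M \<mu>) (\<lambda>z. flow (fst z) (snd z) * h (snd z, fst z))
      \<longleftrightarrow> integrable (\<mu> \<Otimes>\<^sub>M \<mu>) (\<lambda>z. flow (fst z) (snd z) * h z)"
    using integrable_product_swap_iff[of "\<lambda>z. flow (fst z) (snd z) * h z"]
    by (simp only: eq cong: Bochner_Integration.integrable_cong)
  show "(\<integral>z. flow (fst z) (snd z) * h (snd z, fst z) \<partial>(\<mu> \<Otimes>\<^sub>M \<mu>))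
      = (\<integral>z. flow (fst z) (snd z) * h z \<partial>(\<mu> \<Otimes>\<^sub>M \<mu>))"
    by (rule trans[OF Bochner_Integration.integral_cong[OF refl eq[symmetric]] integral_product_swap]) measurable
qed

lemma flow_integrable:
  assumes "square_integrable f" "square_integrable g"
  shows "integrable (\<mu> \<Otimes>\<^sub>M \<mu>) (\<lambda>z. flow (fst z) (snd z) * (f (fst z) * g (fst z)))"
    and "integrable (\<mu> \<Otimes>\<^sub>M \<mu>) (\<lambda>z. flow (fst z) (snd z) * (f (fst z) * g (snd z)))"
    and "integrable (\<mu> \<Otimes>\<^sub>M \<mu>) (\<lambda>z. flow (fst z) (snd z) * (f (snd z) * g (fst z)))"
    and "integrable (\<mu> \<Otimes>\<^sub>M \<mu>) (\<lambda>z. flow (fst z) (snd z) * (f (snd z) * g (snd z)))"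
proof -
  have [measurable]: "f \<in> borel_measurable \<mu>" "g \<in> borel_measurable \<mu>"
    using assms by (auto dest: square_integrable_measurable)
  have nn: "AE z in \<mu> \<Otimes>\<^sub>M \<mu>. 0 \<le> flow (fst z) (snd z)"
    by (intro AE_I2) (auto simp: space_pair_measure flow_nonneg)
  \<comment> \<open>Squares in the second coordinate reduce to the first by exchanging
    coordinates.\<close>
  have s: "integrable (\<mu> \<Otimes>\<^sub>M \<mu>) (\<lambda>z. flow (fst z) (snd z) * (h (snd z))\<^sup>2)" if "square_integrable h" for h
  proof -
    have [measurable]: "h \<in> borel_measurable \<mu>" using that by (rule square_integrable_measurable)
    show ?thesis using flow_swap(1)[of "\<lambda>z. (h (fst z))\<^sup>2"] flow_fst_integrable[OF that] by simp
  qed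
  show "integrable (\<mu> \<Otimes>\<^sub>M \<mu>) (\<lambda>z. flow (fst z) (snd z) * (f (fst z) * g (fst z)))"
    "integrable (\<mu> \<Otimes>\<^sub>M \<mu>) (\<lambda>z. flow (fst z) (snd z) * (f (fst z) * g (snd z)))"
    "integrable (\<mu> \<Otimes>\<^sub>M \<mu>) (\<lambda>z. flow (fst z) (snd z) * (f (snd z) * g (fst z)))"
    "integrable (\<mu> \<Otimes>\<^sub>M \<mu>) (\<lambda>z. flow (fst z) (snd z) * (f (snd z) * g (snd z)))"
    by (rule integrable_mult_of_squares[OF _ _ _ nn]; use assms s flow_fst_integrable in measurable)+
qed

lemma dirichlet_integrable:
  assumes "square_integrable f" "square_integrable g"
  shows "integrable (\<mu> \<Otimes>\<^sub>M \<mu>)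
    (\<lambda>z. flow (fst z) (snd z) * ((f (fst z) - f (snd z)) * (g (fst z) - g (snd z))))"
  using flow_integrable[OF assms] by (simp add: algebra_simps)

section \<open>The kernel as an operator on square-integrable functions\<close>

text \<open>The Bochner integral defaults to 0 when \<open>f\<close> is not integrable, so the
  operator equals the formula \<open>v\<close> only where the absolute moment \<open>u\<close> is
  finite; both are measurable in \<open>x\<close>.\<close>

lemma kernel_op_measurable:
  assumes [measurable]: "f \<in> borel_measurable \<mu>"
  shows "kernel_op kern f \<in> borel_measurable \<mu>"
proof -
  define u where "u x = (\<integral>\<^sup>+y. ennreal (q x y) * (ennreal (rate x y) * ennreal (norm (f y)) + ennreal (1 - rate x y) * ennreal (norm (f x))) \<partial>\<mu>)" for x
  define v where "v x = (\<integral>y. q x y * (rate x y * f y + (1 - rate x y) * f x) \<partial>\<mu>)" for x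
  have u: "u x < \<infinity> \<longleftrightarrow> integrable (kern x) f" if x: "x \<in> space \<mu>" for x
    using nn_integral_kern[of "\<lambda>x. ennreal (norm (f x))" x] x
    by (simp add: u_def integrable_iff_bounded cong: measurable_cong_sets)
  have "kernel_op kern f x = (if u x < \<infinity> then v x else 0)" if x: "x \<in> space \<mu>" for x
    using integral_kern[OF _ assms x] u[OF x]
    by (auto simp: kernel_op_def v_def has_bochner_integral_iff not_integrable_integral_eq)
  moreover have "(\<lambda>x. if u x < \<infinity> then v x else 0) \<in> borel_measurable \<mu>"
    unfolding u_def v_def by measurable
  ultimately show ?thesis by (simp cong: measurable_cong)
qed

text \<open>Jensen's inequality for the square, read off from nonnegativity of the variance; an
  infinite right side is trivial.\<close>

lemma kernel_op_jensen:
  assumes [measurable]: "f \<in> borel_measurable \<mu>" and x: "x \<in> space \<mu>"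
  shows "ennreal ((kernel_op kern f x)\<^sup>2) \<le> (\<integral>\<^sup>+y. ennreal ((f y)\<^sup>2) \<partial>kern x)"
proof (cases "(\<integral>\<^sup>+y. ennreal ((f y)\<^sup>2) \<partial>kern x) < \<infinity>")
  case True
  interpret P: prob_space "kern x" by (rule prob_space_kern[OF x])
  have fm[measurable]: "f \<in> borel_measurable (kern x)" using x by (simp cong: measurable_cong_sets)
  have f2: "integrable (kern x) (\<lambda>y. (f y)\<^sup>2)" using True by (intro integrableI_nonneg) auto
  then have f1: "integrable (kern x) f" by (rule P.square_integrable_imp_integrable[OF fm])
  have "(kernel_op kern f x)\<^sup>2 \<le> (\<integral>y. (f y)\<^sup>2 \<partial>kern x)"
    using P.variance_positive[of f] P.variance_eq[OF f1 f2] by (simp add: kernel_op_def)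
  also have "ennreal \<dots> = (\<integral>\<^sup>+y. ennreal ((f y)\<^sup>2) \<partial>kern x)"
    using f2 by (subst nn_integral_eq_integral) auto
  finally show ?thesis by (simp add: ennreal_leI)
qed (simp add: not_less top.extremum_unique)

text \<open>Jensen's inequality at each point, after which stationarity removes the kernel.\<close>

lemma kernel_op_contraction:
  assumes "square_integrable f"
  shows "square_integrable (kernel_op kern f)"
    and "(\<integral>x. (kernel_op kern f x)\<^sup>2 \<partial>stat) \<le> (\<integral>x. (f x)\<^sup>2 \<partial>stat)"
proof -
  have [measurable]: "f \<in> borel_measurable \<mu>" using assms by (rule square_integrable_measurable)
  note [measurable] = kernel_op_measurable[of f]
  have "(\<integral>\<^sup>+x. ennreal ((kernel_op kern f x)\<^sup>2) \<partial>stat) \<le> (\<integral>\<^sup>+x. (\<integral>\<^sup>+y. ennreal ((f y)\<^sup>2) \<partial>kern x) \<partial>stat)"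
    by (intro nn_integral_mono) (simp add: kernel_op_jensen)
  also have "\<dots> = (\<integral>\<^sup>+x. ennreal ((f x)\<^sup>2) \<partial>stat)" by (rule nn_integral_stat_kern) measurable
  also have "\<dots> = ennreal (\<integral>x. (f x)\<^sup>2 \<partial>stat)"
    using assms by (subst nn_integral_eq_integral) (auto simp: square_integrable_def)
  finally have le: "(\<integral>\<^sup>+x. ennreal ((kernel_op kern f x)\<^sup>2) \<partial>stat) \<le> ennreal (\<integral>x. (f x)\<^sup>2 \<partial>stat)" .
  then have i: "integrable stat (\<lambda>x. (kernel_op kern f x)\<^sup>2)"
    by (intro integrableI_nonneg) (auto intro: le_less_trans)
  then show "square_integrable (kernel_op kern f)"
    by (simp add: square_integrable_def kernel_op_measurable)
  show "(\<integral>x. (kernel_op kern f x)\<^sup>2 \<partial>stat) \<le> (\<integral>x. (f x)\<^sup>2 \<partial>stat)"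
    using le i by (subst (asm) nn_integral_eq_integral) (auto simp: ennreal_le_iff)
qed

text \<open>By stationarity the second moment of \<open>f\<close> under \<open>kern x\<close> is
  finite \<open>stat\<close>-almost everywhere, hence \<open>\<mu>\<close>-almost everywhere as
  \<open>p\<close> is positive. Under a probability measure this gives integrability.\<close>

lemma AE_kern_integrable:
  assumes "square_integrable f"
  shows "AE x in \<mu>. integrable (kern x) f"
proof -
  have [measurable]: "f \<in> borel_measurable \<mu>" using assms by (rule square_integrable_measurable)
  define u where "u x = (\<integral>\<^sup>+y. ennreal (q x y) * (ennreal (rate x y) * ennreal ((f y)\<^sup>2) + ennreal (1 - rate x y) * ennreal ((f x)\<^sup>2)) \<partial>\<mu>)" for x
  have um: "u \<in> borel_measurable \<mu>" unfolding u_def[abs_def] by measurable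
  have u: "u x = (\<integral>\<^sup>+y. ennreal ((f y)\<^sup>2) \<partial>kern x)" if "x \<in> space \<mu>" for x
    using that by (subst nn_integral_kern) (auto simp: u_def)
  have "(\<integral>\<^sup>+x. u x \<partial>stat) = (\<integral>\<^sup>+x. (\<integral>\<^sup>+y. ennreal ((f y)\<^sup>2) \<partial>kern x) \<partial>stat)"
    by (intro nn_integral_cong) (simp add: u)
  also have "\<dots> = (\<integral>\<^sup>+x. ennreal ((f x)\<^sup>2) \<partial>stat)"
    by (rule nn_integral_stat_kern) measurable
  also have "\<dots> < \<infinity>" using assms by (simp add: square_integrable_def integrable_iff_bounded)
  finally have "AE x in stat. u x \<noteq> \<infinity>" using um by (intro nn_integral_noteq_infinite) auto
  then have "AE x in \<mu>. p x > 0 \<longrightarrow> u x \<noteq> \<infinity>" by (subst (asm) AE_density) auto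
  with AE_space show ?thesis
  proof eventually_elim
    case (elim x)
    interpret P: prob_space "kern x" by (rule prob_space_kern) (use elim in simp)
    have fm: "f \<in> borel_measurable (kern x)" using elim by (simp cong: measurable_cong_sets)
    have "integrable (kern x) (\<lambda>y. (f y)\<^sup>2)"
      using elim p_pos u[of x] fm by (intro integrableI_nonneg) (auto simp: less_top)
    then show ?case by (rule P.square_integrable_imp_integrable[OF fm])
  qed
qed

text \<open>For almost every \<open>x\<close>, the defect
  \<open>p x * (f x - kernel_op kern f x) * g x\<close> is the integral over \<open>y\<close> of the
  flow times \<open>(f x - f y) * g x\<close>. Averaging with the exchanged coordinates produces the
  Dirichlet form.\<close>

lemma inner_kernel_op:
  assumes f: "square_integrable f" and g: "square_integrable g"
  shows "(\<integral>x. kernel_op kern f x * g x \<partial>stat) = (\<integral>x. f x * g x \<partial>stat) - dirichlet f g"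
proof -
  have [measurable]: "f \<in> borel_measurable \<mu>" "g \<in> borel_measurable \<mu>"
    using assms by (auto dest: square_integrable_measurable)
  note [measurable] = kernel_op_measurable[of f]
  \<comment> \<open>One-sided integrand; its exchanged copy has the same integral, which absorbs the
    factor 1/2.\<close>
  define F where "F z = flow (fst z) (snd z) * ((f (fst z) - f (snd z)) * g (fst z))" for z
  have F: "integrable (\<mu> \<Otimes>\<^sub>M \<mu>) F"
    using flow_integrable[OF assms] by (simp add: F_def[abs_def] algebra_simps)
  have F': "integrable (\<mu> \<Otimes>\<^sub>M \<mu>) (\<lambda>z. flow (fst z) (snd z) * ((f (snd z) - f (fst z)) * g (snd z)))"
    using flow_integrable[OF assms] by (simp add: algebra_simps)
  have "dirichlet f g = ((\<integral>z. F z + flow (fst z) (snd z) * ((f (snd z) - f (fst z)) * g (snd z)) \<partial>(\<mu> \<Otimes>\<^sub>M \<mu>))) / 2"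
    by (simp add: dirichlet_def F_def algebra_simps)
  also have "\<dots> = ((\<integral>z. F z \<partial>(\<mu> \<Otimes>\<^sub>M \<mu>)) + (\<integral>z. F z \<partial>(\<mu> \<Otimes>\<^sub>M \<mu>))) / 2"
    using flow_swap(2)[of "\<lambda>z. (f (fst z) - f (snd z)) * g (fst z)"] F F'
    by (subst Bochner_Integration.integral_add) (simp_all add: F_def[abs_def])
  finally have D: "dirichlet f g = (\<integral>z. F z \<partial>(\<mu> \<Otimes>\<^sub>M \<mu>))" by simp
  have "AE x in \<mu>. p x * (kernel_op kern f x * g x) = p x * (f x * g x) - (\<integral>y. F (x, y) \<partial>\<mu>)"
    using AE_kern_integrable[OF f] AE_space
  proof eventually_elim
    case (elim x)
    have [measurable]: "(\<lambda>y. q x y) \<in> borel_measurable \<mu>" using elim by measurable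
    \<comment> \<open>The proposal has mass 1, so \<open>f x\<close> becomes an integral against
      \<open>q x\<close> and merges with the kernel integral.\<close>
    have "has_bochner_integral \<mu> (\<lambda>y. q x y) 1"
      using q_prob[of x] q_nonneg elim by (intro has_bochner_integral_nn_integral) auto
    then have "has_bochner_integral \<mu> (\<lambda>y. q x y * f x - q x y * (rate x y * f y + (1 - rate x y) * f x))
        (1 * f x - kernel_op kern f x)"
      unfolding kernel_op_def using elim
      by (intro has_bochner_integral_diff has_bochner_integral_mult_left integral_kern) auto
    then have "has_bochner_integral \<mu> (\<lambda>y. (p x * g x) * (q x y * f x - q x y * (rate x y * f y + (1 - rate x y) * f x)))
        ((p x * g x) * (1 * f x - kernel_op kern f x))"
      by (intro has_bochner_integral_mult_right)
    moreover have "(p x * g x) * (q x y * f x - q x y * (rate x y * f y + (1 - rate x y) * f x)) = F (x, y)" for y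
      by (simp add: F_def flow_def algebra_simps)
    ultimately show ?case by (simp add: has_bochner_integral_iff algebra_simps)
  qed
  then have "(\<integral>x. p x * (kernel_op kern f x * g x) \<partial>\<mu>) = (\<integral>x. p x * (f x * g x) - (\<integral>y. F (x, y) \<partial>\<mu>) \<partial>\<mu>)"
    using integrable_fst'[OF F] by (intro integral_cong_AE) auto
  moreover have "integrable \<mu> (\<lambda>x. p x * (f x * g x))"
    using square_integrable_mult[OF assms] p_pos by (subst (asm) integrable_density) (auto intro!: AE_I2 less_imp_le)
  moreover have st: "(\<integral>x. h x \<partial>stat) = (\<integral>x. p x * h x \<partial>\<mu>)" if "h \<in> borel_measurable \<mu>" for h :: "'a \<Rightarrow> real"
    using that p_pos by (subst integral_density) (auto intro!: AE_I2 less_imp_le)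
  ultimately show ?thesis
    using integrable_fst'[OF F] integral_fst'[OF F] by (simp add: D)
qed

end

section \<open>Comparison of spectral gaps\<close>

text \<open>For a unit vector \<open>g\<close>, removing from \<open>f\<close> its projection
  \<open>t * g\<close> leaves a function with nonnegative squared norm.\<close>

lemma Cauchy_Schwarz_integral:
  fixes f g :: "'b \<Rightarrow> real"
  assumes "integrable P (\<lambda>x. (f x)\<^sup>2)" "integrable P (\<lambda>x. (g x)\<^sup>2)" "integrable P (\<lambda>x. f x * g x)"
    and "(\<integral>x. (g x)\<^sup>2 \<partial>P) = 1"
  shows "(\<integral>x. f x * g x \<partial>P)\<^sup>2 \<le> (\<integral>x. (f x)\<^sup>2 \<partial>P)"
proof -
  define t where "t = (\<integral>x. f x * g x \<partial>P)"
  have "0 \<le> (\<integral>x. (f x - t * g x)\<^sup>2 \<partial>P)" by simp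
  also have "(\<lambda>x. (f x - t * g x)\<^sup>2) = (\<lambda>x. (f x)\<^sup>2 - 2 * t * (f x * g x) + t\<^sup>2 * (g x)\<^sup>2)"
    by (auto simp: power2_eq_square algebra_simps)
  also have "(\<integral>x. (f x)\<^sup>2 - 2 * t * (f x * g x) + t\<^sup>2 * (g x)\<^sup>2 \<partial>P) = (\<integral>x. (f x)\<^sup>2 \<partial>P) - 2 * t * t + t\<^sup>2 * 1"
    using assms by (simp add: t_def)
  finally show ?thesis by (simp add: t_def power2_eq_square)
qed

context accept_kernel begin

section \<open>Mean-zero functions and the quadratic form of the kernel\<close>

lemma L2_zero_mean_iff:
  "f \<in> L2_zero_mean stat \<longleftrightarrow> square_integrable f \<and> (\<integral>x. f x \<partial>stat) = 0"
  by (auto simp: L2_zero_mean_def square_integrable_def)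

lemma integrable_of_square_integrable: "square_integrable f \<Longrightarrow> integrable stat f"
  using square_integrable_mult[OF _ square_integrable_const[of 1]] by simp

lemma L2_zero_mean_linear:
  assumes "f \<in> L2_zero_mean stat" "g \<in> L2_zero_mean stat"
  shows "(\<lambda>x. a * f x + b * g x) \<in> L2_zero_mean stat"
  using assms by (simp add: L2_zero_mean_iff square_integrable_linear integrable_of_square_integrable)

text \<open>Tested against the constant 1, whose differences vanish, the Dirichlet form is 0, so the
  mean is preserved.\<close>

lemma kernel_op_L2_zero_mean:
  assumes "f \<in> L2_zero_mean stat"
  shows "kernel_op kern f \<in> L2_zero_mean stat"
proof -
  have f: "square_integrable f" "(\<integral>x. f x \<partial>stat) = 0" using assms by (auto simp: L2_zero_mean_iff)
  have "(\<integral>x. kernel_op kern f x * 1 \<partial>stat) = (\<integral>x. f x * 1 \<partial>stat) - dirichlet f (\<lambda>_. 1)"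
    by (rule inner_kernel_op[OF f(1) square_integrable_const])
  then show ?thesis
    using f kernel_op_contraction(1)[OF f(1)] by (simp add: L2_zero_mean_iff dirichlet_def)
qed

text \<open>The quadratic form of the kernel, written through the Dirichlet form because that is
  monotone in the flow.\<close>

definition form :: "('a \<Rightarrow> real) \<Rightarrow> real" where
  "form f = (\<integral>x. (f x)\<^sup>2 \<partial>stat) - dirichlet f f"

lemma dirichlet_polarization:
  assumes "square_integrable f" "square_integrable g"
  shows "dirichlet (\<lambda>x. f x + g x) (\<lambda>x. f x + g x) - dirichlet (\<lambda>x. f x - g x) (\<lambda>x. f x - g x) = 4 * dirichlet f g"
proof -
  have s: "square_integrable (\<lambda>x. f x + g x)" "square_integrable (\<lambda>x. f x - g x)"
    using square_integrable_linear[OF assms, of 1 1] square_integrable_linear[OF assms, of 1 "-1"] by simp_all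
  have "dirichlet (\<lambda>x. f x + g x) (\<lambda>x. f x + g x) - dirichlet (\<lambda>x. f x - g x) (\<lambda>x. f x - g x)
    = (\<integral>z. 4 * (flow (fst z) (snd z) * ((f (fst z) - f (snd z)) * (g (fst z) - g (snd z)))) \<partial>(\<mu> \<Otimes>\<^sub>M \<mu>)) / 2"
    unfolding dirichlet_def diff_divide_distrib[symmetric]
      Bochner_Integration.integral_diff[OF dirichlet_integrable[OF s(1) s(1)] dirichlet_integrable[OF s(2) s(2)], symmetric]
    by (intro arg_cong[where f = "\<lambda>x. x / 2"] Bochner_Integration.integral_cong) (auto simp: algebra_simps)
  then show ?thesis by (simp add: dirichlet_def)
qed

text \<open>Polarization and the parallelogram law; together they turn a bound on the quadratic form
  into one on the operator norm.\<close>

lemma form_polarization: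
  assumes "square_integrable f" "square_integrable g"
  shows "form (\<lambda>x. f x + g x) - form (\<lambda>x. f x - g x) = 4 * (\<integral>x. kernel_op kern f x * g x \<partial>stat)"
    and "(\<integral>x. (f x + g x)\<^sup>2 \<partial>stat) + (\<integral>x. (f x - g x)\<^sup>2 \<partial>stat) = 2 * (\<integral>x. (f x)\<^sup>2 \<partial>stat) + 2 * (\<integral>x. (g x)\<^sup>2 \<partial>stat)"
proof -
  have i: "integrable stat (\<lambda>x. (f x)\<^sup>2)" "integrable stat (\<lambda>x. (g x)\<^sup>2)" "integrable stat (\<lambda>x. f x * g x)"
    using assms square_integrable_mult[OF assms] by (auto simp: square_integrable_def)
  have p: "(\<integral>x. (f x + g x)\<^sup>2 \<partial>stat) = (\<integral>x. (f x)\<^sup>2 \<partial>stat) + (\<integral>x. (g x)\<^sup>2 \<partial>stat) + 2 * (\<integral>x. f x * g x \<partial>stat)"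
    using i by (simp add: power2_sum mult.assoc)
  have m: "(\<integral>x. (f x - g x)\<^sup>2 \<partial>stat) = (\<integral>x. (f x)\<^sup>2 \<partial>stat) + (\<integral>x. (g x)\<^sup>2 \<partial>stat) - 2 * (\<integral>x. f x * g x \<partial>stat)"
    using i by (simp add: power2_diff mult.assoc)
  show "form (\<lambda>x. f x + g x) - form (\<lambda>x. f x - g x) = 4 * (\<integral>x. kernel_op kern f x * g x \<partial>stat)"
    using dirichlet_polarization[OF assms] by (simp add: form_def p m inner_kernel_op[OF assms])
  show "(\<integral>x. (f x + g x)\<^sup>2 \<partial>stat) + (\<integral>x. (f x - g x)\<^sup>2 \<partial>stat) = 2 * (\<integral>x. (f x)\<^sup>2 \<partial>stat) + 2 * (\<integral>x. (g x)\<^sup>2 \<partial>stat)"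
    by (simp add: p m)
qed

lemma L2_fun_norm_eq_1: "L2_fun_norm P f = 1 \<longleftrightarrow> (\<integral>x. (f x)\<^sup>2 \<partial>P) = 1"
  by (simp add: L2_fun_norm_def)

text \<open>Comparing elements with a real supremum needs an upper bound on the set; contraction
  supplies 1.\<close>

lemma kernel_norm_set_bounded:
  "x \<in> insert 0 {L2_fun_norm stat (kernel_op kern f) | f. f \<in> L2_zero_mean stat \<and> L2_fun_norm stat f = 1} \<Longrightarrow> x \<le> 1"
  using kernel_op_contraction(2) by (auto simp: L2_fun_norm_eq_1 L2_zero_mean_iff L2_fun_norm_def) fastforce

lemma kernel_norm_le_1: "kernel_norm stat kern \<le> 1"
  unfolding kernel_norm_def by (rule cSup_least) (auto intro!: kernel_norm_set_bounded)

text \<open>A self-adjoint operator is bounded by any bound on its quadratic form: polarize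
  \<open>\<langle>P f, P f / \<parallel>P f\<parallel>\<rangle>\<close>.\<close>
lemma kernel_norm_le:
  assumes "\<kappa> \<ge> 0" and form: "\<And>f. f \<in> L2_zero_mean stat \<Longrightarrow> \<bar>form f\<bar> \<le> \<kappa> * (\<integral>x. (f x)\<^sup>2 \<partial>stat)"
  shows "kernel_norm stat kern \<le> \<kappa>"
proof -
  have "L2_fun_norm stat (kernel_op kern f) \<le> \<kappa>" if f: "f \<in> L2_zero_mean stat" "L2_fun_norm stat f = 1" for f
  proof (cases "L2_fun_norm stat (kernel_op kern f) = 0")
    case False
    define b where "b = L2_fun_norm stat (kernel_op kern f)"
    have b: "b > 0" using False by (simp add: b_def L2_fun_norm_def less_le)
    have b2: "(\<integral>x. (kernel_op kern f x)\<^sup>2 \<partial>stat) = b\<^sup>2" by (simp add: b_def L2_fun_norm_def)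
    \<comment> \<open>The summand \<open>0 * f x\<close> only fits \<open>g\<close> to the shape of
      \<open>L2_zero_mean_linear\<close>.\<close>
    define g where "g = (\<lambda>x. 1 / b * kernel_op kern f x + 0 * f x)"
    have g: "g \<in> L2_zero_mean stat"
      unfolding g_def using kernel_op_L2_zero_mean[OF f(1)] f(1) by (rule L2_zero_mean_linear)
    have fg: "square_integrable f" "square_integrable g" using f g by (auto simp: L2_zero_mean_iff)
    have pm: "(\<lambda>x. f x + g x) \<in> L2_zero_mean stat" "(\<lambda>x. f x - g x) \<in> L2_zero_mean stat"
      using L2_zero_mean_linear[OF f(1) g, of 1 1] L2_zero_mean_linear[OF f(1) g, of 1 "-1"] by simp_all
    have "(\<integral>x. (g x)\<^sup>2 \<partial>stat) = 1" using b by (simp add: g_def power_divide b2)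
    moreover have "(\<integral>x. kernel_op kern f x * g x \<partial>stat) = b"
    proof -
      have "(\<lambda>x. kernel_op kern f x * g x) = (\<lambda>x. 1 / b * (kernel_op kern f x)\<^sup>2)"
        by (auto simp: g_def power2_eq_square)
      then show ?thesis using b by (simp add: b2) (simp add: power2_eq_square)
    qed
    ultimately have "4 * b \<le> \<kappa> * 4"
    proof -
      assume g1: "(\<integral>x. (g x)\<^sup>2 \<partial>stat) = 1" and eq: "(\<integral>x. kernel_op kern f x * g x \<partial>stat) = b"
      have "4 * b = form (\<lambda>x. f x + g x) - form (\<lambda>x. f x - g x)"
        unfolding form_polarization(1)[OF fg] eq ..
      also have "\<dots> \<le> \<bar>form (\<lambda>x. f x + g x)\<bar> + \<bar>form (\<lambda>x. f x - g x)\<bar>" by simp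
      also have "\<dots> \<le> \<kappa> * (\<integral>x. (f x + g x)\<^sup>2 \<partial>stat) + \<kappa> * (\<integral>x. (f x - g x)\<^sup>2 \<partial>stat)"
        by (intro add_mono form pm)
      \<comment> \<open>Both \<open>f\<close> and \<open>g\<close> have norm 1, so the parallelogram
        law gives a total of 4.\<close>
      also have "\<dots> = \<kappa> * 4"
        unfolding distrib_left[symmetric] form_polarization(2)[OF fg] g1
        using f(2) by (simp add: L2_fun_norm_eq_1)
      finally show ?thesis .
    qed
    then show ?thesis by (simp add: b_def)
  qed (use \<open>\<kappa> \<ge> 0\<close> in simp)
  then show ?thesis
    unfolding kernel_norm_def using \<open>\<kappa> \<ge> 0\<close> by (intro cSup_least) auto
qed

lemma form_scale: "form (\<lambda>x. c * f x) = c\<^sup>2 * form f"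
proof -
  have eq: "w * ((c * a - c * b) * (c * a - c * b)) = c\<^sup>2 * (w * ((a - b) * (a - b)))" for w a b :: real
    by algebra
  have "dirichlet (\<lambda>x. c * f x) (\<lambda>x. c * f x) = c\<^sup>2 * dirichlet f f"
    unfolding dirichlet_def times_divide_eq_right Bochner_Integration.integral_mult_right_zero[symmetric]
    by (simp only: eq)
  then show ?thesis by (simp add: form_def power_mult_distrib right_diff_distrib)
qed

lemma form_eq_inner: "square_integrable f \<Longrightarrow> form f = (\<integral>x. kernel_op kern f x * f x \<partial>stat)"
  by (simp add: form_def inner_kernel_op power2_eq_square)

text \<open>Cauchy-Schwarz for the normalised function, then homogeneity. A function of norm 0
  cannot be normalised, but it vanishes almost everywhere and so does its form.\<close>

lemma form_le_kernel_norm: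
  assumes f: "f \<in> L2_zero_mean stat"
  shows "\<bar>form f\<bar> \<le> kernel_norm stat kern * (\<integral>x. (f x)\<^sup>2 \<partial>stat)"
proof (cases "(\<integral>x. (f x)\<^sup>2 \<partial>stat) = 0")
  case True
  have sf: "square_integrable f" using f by (simp add: L2_zero_mean_iff)
  have "AE x in stat. (f x)\<^sup>2 = 0"
    using True sf integral_nonneg_eq_0_iff_AE[of stat "\<lambda>x. (f x)\<^sup>2"] by (simp add: square_integrable_def)
  then have "AE x in stat. kernel_op kern f x * f x = 0" by eventually_elim simp
  then have "form f = 0" unfolding form_eq_inner[OF sf] by (rule integral_eq_zero_AE)
  then show ?thesis using True by simp
next
  case False
  have sf: "square_integrable f" using f by (simp add: L2_zero_mean_iff)
  define n where "n = (\<integral>x. (f x)\<^sup>2 \<partial>stat)"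
  have n: "n > 0" using False by (simp add: n_def less_le)
  define c where "c = 1 / sqrt n"
  have c2: "c\<^sup>2 = 1 / n" using n by (simp add: c_def power_divide)
  define g where "g = (\<lambda>x. c * f x)"
  have g: "g \<in> L2_zero_mean stat"
    unfolding g_def using L2_zero_mean_linear[OF f f, of c 0] by simp
  have sg: "square_integrable g" using g by (simp add: L2_zero_mean_iff)
  have g1: "(\<integral>x. (g x)\<^sup>2 \<partial>stat) = 1"
    using n by (simp add: g_def power_mult_distrib n_def[symmetric] c2)
  have "(form g)\<^sup>2 \<le> (\<integral>x. (kernel_op kern g x)\<^sup>2 \<partial>stat)"
    unfolding form_eq_inner[OF sg] using sg kernel_op_contraction(1)[OF sg] g1
    by (intro Cauchy_Schwarz_integral square_integrable_mult) (auto simp: square_integrable_def)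
  then have "\<bar>form g\<bar> \<le> L2_fun_norm stat (kernel_op kern g)"
    unfolding L2_fun_norm_def by (intro real_le_rsqrt) simp
  also have "\<dots> \<le> kernel_norm stat kern"
    unfolding kernel_norm_def using g g1 kernel_norm_set_bounded
    by (intro cSup_upper bdd_aboveI[where M = 1]) (auto simp: L2_fun_norm_eq_1)
  finally have "\<bar>form f\<bar> / n \<le> kernel_norm stat kern"
    using n by (simp add: g_def form_scale c2 abs_mult)
  then show ?thesis using n by (simp add: n_def[symmetric] pos_divide_le_eq)
qed

end

text \<open>Comparing Dirichlet forms from both sides controls both ends of the spectrum, hence the
  absolute spectral gap.\<close>
lemma spectral_gap_comparison:
  assumes "accept_kernel \<mu> p q acc" "accept_kernel \<mu> p q acc'"
    and c: "0 \<le> c" "c \<le> 1"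
    and le: "\<And>x y. x \<in> space \<mu> \<Longrightarrow> y \<in> space \<mu> \<Longrightarrow> q x y > 0 \<Longrightarrow>
      c * pmf (acc x y) True \<le> pmf (acc' x y) True \<and> pmf (acc' x y) True \<le> pmf (acc x y) True"
  shows "c * spectral_gap (density \<mu> p) (propose_accept \<mu> q acc)
    \<le> spectral_gap (density \<mu> p) (propose_accept \<mu> q acc')"
proof -
  interpret A: accept_kernel \<mu> p q acc by fact
  interpret B: accept_kernel \<mu> p q acc' by fact
  define n where "n = kernel_norm (density \<mu> p) (propose_accept \<mu> q acc)"
  \<comment> \<open>With \<open>n\<close> the norm of the first chain, the right side is the norm
    that corresponds to \<open>c\<close> times its gap.\<close>
  have "kernel_norm (density \<mu> p) (propose_accept \<mu> q acc') \<le> 1 - c * (1 - n)"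
  proof (rule B.kernel_norm_le)
    show "0 \<le> 1 - c * (1 - n)"
    proof -
      have "n \<ge> 0" unfolding n_def kernel_norm_def
        using A.kernel_norm_set_bounded by (intro cSup_upper bdd_aboveI[where M = 1]) auto
      then have "c * (1 - n) \<le> 1 * 1" using A.kernel_norm_le_1 c unfolding n_def by (intro mult_mono) auto
      then show ?thesis by simp
    qed
  next
    fix f assume f: "f \<in> L2_zero_mean (density \<mu> p)"
    have sf: "A.square_integrable f" using f by (simp add: A.L2_zero_mean_iff)
    have sf': "B.square_integrable f" using f by (simp add: B.L2_zero_mean_iff)
    define v where "v = (\<integral>x. (f x)\<^sup>2 \<partial>density \<mu> p)"
    have v: "v \<ge> 0" by (simp add: v_def)
    have flow: "c * A.flow x y \<le> B.flow x y" "B.flow x y \<le> A.flow x y" if "x \<in> space \<mu>" "y \<in> space \<mu>" for x y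
    proof -
      have "c * A.flow x y \<le> B.flow x y \<and> B.flow x y \<le> A.flow x y"
      \<comment> \<open>Where \<open>q x y = 0\<close> both flows vanish, so the rates need
        comparing only at possible proposals.\<close>
      proof (cases "q x y = 0")
        case False
        then have "q x y > 0" using A.q_nonneg[OF that] by simp
        then have "0 < p x * q x y" using A.p_pos[OF that(1)] by simp
        then show ?thesis using le[OF that \<open>q x y > 0\<close>]
          unfolding A.flow_def B.flow_def A.rate_def B.rate_def
          unfolding mult.left_commute[of c] by (auto intro!: mult_left_mono)
      qed (simp add: A.flow_def B.flow_def)
      then show "c * A.flow x y \<le> B.flow x y" "B.flow x y \<le> A.flow x y" by auto
    qed
    define h where "h z = (f (fst z) - f (snd z)) * (f (fst z) - f (snd z))" for z :: "'a \<times> 'a"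
    have h: "h z \<ge> 0" for z by (simp add: h_def)
    note iA = A.dirichlet_integrable[OF sf sf, folded h_def]
      and iB = B.dirichlet_integrable[OF sf' sf', folded h_def]
    have d1: "c * A.dirichlet f f \<le> B.dirichlet f f"
    proof -
      have "(\<integral>z. c * (A.flow (fst z) (snd z) * h z) \<partial>(\<mu> \<Otimes>\<^sub>M \<mu>)) \<le> (\<integral>z. B.flow (fst z) (snd z) * h z \<partial>(\<mu> \<Otimes>\<^sub>M \<mu>))"
      proof (rule integral_mono[OF integrable_mult_right[OF iA] iB])
        fix z assume "z \<in> space (\<mu> \<Otimes>\<^sub>M \<mu>)"
        then have "c * A.flow (fst z) (snd z) * h z \<le> B.flow (fst z) (snd z) * h z"
          using h by (intro mult_right_mono flow) (auto simp: space_pair_measure)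
        then show "c * (A.flow (fst z) (snd z) * h z) \<le> B.flow (fst z) (snd z) * h z" by simp
      qed
      then show ?thesis by (simp add: A.dirichlet_def B.dirichlet_def h_def)
    qed
    have d2: "B.dirichlet f f \<le> A.dirichlet f f"
    proof -
      have "(\<integral>z. B.flow (fst z) (snd z) * h z \<partial>(\<mu> \<Otimes>\<^sub>M \<mu>)) \<le> (\<integral>z. A.flow (fst z) (snd z) * h z \<partial>(\<mu> \<Otimes>\<^sub>M \<mu>))"
        using h by (intro integral_mono[OF iB iA] mult_right_mono flow) (auto simp: space_pair_measure)
      then show ?thesis by (simp add: A.dirichlet_def B.dirichlet_def h_def)
    qed
    have "\<bar>A.form f\<bar> \<le> n * v" unfolding n_def v_def by (rule A.form_le_kernel_norm[OF f])
    moreover have nv: "(1 - n) * v = v - n * v" by (simp add: left_diff_distrib)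
    moreover have "A.form f = v - A.dirichlet f f" by (simp add: A.form_def v_def)
    \<comment> \<open>The first inequality concerns the bottom of the spectrum of the first chain,
      the second its top.\<close>
    ultimately have A: "- (n * v) \<le> v - A.dirichlet f f" "(1 - n) * v \<le> A.dirichlet f f"
      by linarith+
    have "c * ((1 - n) * v) \<le> c * A.dirichlet f f" using A(2) c(1) by (rule mult_left_mono)
    \<comment> \<open>For the bottom: \<open>d2\<close> and \<open>A(1)\<close> give the lower bound
      \<open>- (n * v)\<close> for the second form, and this step shows that it is at least
      \<open>c * ((1 - n) * v) - v\<close>.\<close>
    moreover have "c * ((1 - n) * v) \<le> (1 - n) * v"
      using c v A.kernel_norm_le_1 unfolding n_def by (intro mult_left_le_one_le) auto
    ultimately have "\<bar>v - B.dirichlet f f\<bar> \<le> v - c * ((1 - n) * v)"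
      using A(1) d1 d2 nv by linarith
    also have "v - c * ((1 - n) * v) = (1 - c * (1 - n)) * v"
      by (metis left_diff_distrib mult.assoc mult_1)
    finally show "\<bar>B.form f\<bar> \<le> (1 - c * (1 - n)) * (\<integral>x. (f x)\<^sup>2 \<partial>density \<mu> p)"
      unfolding B.form_def v_def .
  qed
  then show ?thesis by (simp add: spectral_gap_def n_def[symmetric])
qed

section \<open>Acceptance rates of PoissonMH\<close>

text \<open>Measurability of an integral in a parameter rests on a sigma-finite measure, which
  counting measure on an uncountable type is not; hence the restriction to a countable set carrying
  \<open>f\<close>.\<close>

lemma borel_measurable_integral_count_space:
  fixes f :: "'a \<Rightarrow> 'b \<Rightarrow> real"
  assumes "countable S" and "\<And>s. s \<in> S \<Longrightarrow> (\<lambda>z. f z s) \<in> borel_measurable M"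
    and "\<And>z s. z \<in> space M \<Longrightarrow> s \<notin> S \<Longrightarrow> f z s = 0"
  shows "(\<lambda>z. \<integral>s. f z s \<partial>count_space UNIV) \<in> borel_measurable M"
proof -
  interpret sigma_finite_measure "count_space S"
    by (rule sigma_finite_measure_count_space_countable[OF assms(1)])
  have "(\<lambda>(s, z). f z s) \<in> borel_measurable (count_space S \<Otimes>\<^sub>M M)"
    using assms by (intro measurable_pair_measure_countable1) auto
  then have "(\<lambda>(z, s). f z s) \<in> borel_measurable (M \<Otimes>\<^sub>M count_space S)"
    by (subst (asm) measurable_pair_swap_iff) (simp add: case_prod_beta')
  then have "(\<lambda>z. \<integral>s. f z s \<partial>count_space S) \<in> borel_measurable M"
    by (rule borel_measurable_lebesgue_integral)
  moreover have "(\<integral>s. f z s \<partial>count_space S) = (\<integral>s. f z s \<partial>count_space UNIV)" if "z \<in> space M" for z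
  proof -
    have "(\<integral>s. f z s \<partial>count_space S) = (\<integral>s. indicator S s *\<^sub>R f z s \<partial>count_space UNIV)"
      using integral_restrict_space[of S "count_space UNIV" "f z"] by (simp add: restrict_count_space)
    also have "\<dots> = (\<integral>s. f z s \<partial>count_space UNIV)"
      using assms(3)[OF that] by (intro Bochner_Integration.integral_cong) (auto simp: indicator_def)
    finally show ?thesis .
  qed
  ultimately show ?thesis by (simp cong: measurable_cong)
qed

text \<open>A normalising integral of 0 would make the density vanish, as division by 0 gives 0. A
  nonzero Bochner integral forces integrability, and \<open>u \<ge> 1\<close> then makes
  \<open>\<mu>\<close> finite.\<close>

lemma normalized_density_base:
  assumes prob: "prob_space (density \<mu> (\<lambda>x. ennreal (u x / (\<integral>x. u x \<partial>\<mu>))))"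
    and u: "u \<in> borel_measurable \<mu>" "\<And>x. x \<in> space \<mu> \<Longrightarrow> (1::real) \<le> u x"
  shows "0 < (\<integral>x. u x \<partial>\<mu>)" and "sigma_finite_measure \<mu>"
proof -
  have "(\<integral>x. u x \<partial>\<mu>) \<noteq> 0"
  proof
    assume 0: "(\<integral>x. u x \<partial>\<mu>) = 0"
    have "emeasure (density \<mu> (\<lambda>x. ennreal (u x / (\<integral>x. u x \<partial>\<mu>)))) (space \<mu>) = 0"
      unfolding 0 by (subst emeasure_density) auto
    then show False using prob_space.emeasure_space_1[OF prob] by simp
  qed
  moreover have "(\<integral>x. u x \<partial>\<mu>) \<ge> 0"
    using u(2) by (intro integral_nonneg_AE AE_I2) (auto intro: order_trans[of _ 1])
  ultimately show "0 < (\<integral>x. u x \<partial>\<mu>)" by simp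
  then have "integrable \<mu> u" using not_integrable_integral_eq by fastforce
  then have "(\<integral>\<^sup>+x. ennreal (norm (u x)) \<partial>\<mu>) < \<infinity>" by (simp add: integrable_iff_bounded)
  moreover have "(\<integral>\<^sup>+x. 1 \<partial>\<mu>) \<le> (\<integral>\<^sup>+x. ennreal (norm (u x)) \<partial>\<mu>)"
  proof (rule nn_integral_mono)
    fix x assume "x \<in> space \<mu>"
    then have "1 \<le> norm (u x)" using u(2) by force
    then show "1 \<le> ennreal (norm (u x))" by (metis ennreal_1 ennreal_leI)
  qed
  ultimately have "emeasure \<mu> (space \<mu>) < \<infinity>" by simp
  then have "finite_measure \<mu>" by (intro finite_measureI) auto
  then show "sigma_finite_measure \<mu>" by (simp add: finite_measure_def)
qed

text \<open>Splits the ratio into the likelihood ratio of the counts and the ideal acceptance ratio.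
  The part of the log-likelihood free of \<open>s\<close>, a sum of
  \<open>\<phi> i x - \<phi> i y\<close>, cancels the ratio of target densities.\<close>

lemma poisson_mh_ratio_eq:
  assumes M: "\<And>i. i \<in> {1..N} \<Longrightarrow> M i > 0" and l: "l > 0" and L: "L > 0"
    and x: "\<And>i. i \<in> {1..N} \<Longrightarrow> \<phi> i x \<ge> 0" and y: "\<And>i. i \<in> {1..N} \<Longrightarrow> \<phi> i y \<ge> 0"
    and Z: "(\<integral>z. exp (\<Sum>i=1..N. \<phi> i z) \<partial>\<mu>) > 0"
  shows "poisson_mh_ratio q N \<phi> M L l x y s =
    exp (poisson_loglik {1..N} (\<lambda>i. l * M i / L + \<phi> i x) (\<lambda>i. l * M i / L + \<phi> i y) s)
      * ((target_density \<mu> N \<phi> y * q y x) / (target_density \<mu> N \<phi> x * q x y))"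
proof -
  define t where "t z i = ln (1 + L / (l * M i) * \<phi> i z)" for z i
  define S where "S = {i \<in> {1..N}. s i > 0}"
  have t: "(\<Sum>i\<in>S. real (s i) * t z i) = (\<Sum>i=1..N. real (s i) * t z i)" for z
    unfolding S_def by (rule sum.mono_neutral_left) auto
  have ln: "ln ((l * M i / L + \<phi> i y) / (l * M i / L + \<phi> i x)) = t y i - t x i" if i: "i \<in> {1..N}" for i
  proof -
    define c where "c = l * M i / L"
    have c: "c > 0" using M[OF i] l L by (simp add: c_def)
    \<comment> \<open>Both logarithms carry the factor \<open>1 / c\<close>, which cancels in their
      difference.\<close>
    have e: "1 + L / (l * M i) * v = (c + v) / c" for v
      using M[OF i] l L by (simp add: c_def field_simps)
    have "c + \<phi> i y > 0" "c + \<phi> i x > 0" using c x[OF i] y[OF i] by auto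
    then show ?thesis
      unfolding t_def e c_def[symmetric] using c by (simp add: ln_div)
  qed
  have "poisson_loglik {1..N} (\<lambda>i. l * M i / L + \<phi> i x) (\<lambda>i. l * M i / L + \<phi> i y) s
      = (\<Sum>i=1..N. real (s i) * t y i - real (s i) * t x i + (\<phi> i x - \<phi> i y))"
    unfolding poisson_loglik_def by (intro sum.cong refl) (simp add: ln right_diff_distrib)
  also have "\<dots> = (\<Sum>i=1..N. real (s i) * t y i) - (\<Sum>i=1..N. real (s i) * t x i)
      + ((\<Sum>i=1..N. \<phi> i x) - (\<Sum>i=1..N. \<phi> i y))"
    by (simp add: sum.distrib sum_subtractf)
  finally have "exp (poisson_loglik {1..N} (\<lambda>i. l * M i / L + \<phi> i x) (\<lambda>i. l * M i / L + \<phi> i y) s)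
      = exp (\<Sum>i=1..N. real (s i) * t y i) / exp (\<Sum>i=1..N. real (s i) * t x i)
        * (exp (\<Sum>i=1..N. \<phi> i x) / exp (\<Sum>i=1..N. \<phi> i y))"
    by (simp only: exp_add exp_diff)
  then show ?thesis
    using Z unfolding poisson_mh_ratio_def Let_def S_def[symmetric] t_def[symmetric] t target_density_def
    by simp
qed

theorem proposition4:
  fixes \<mu> :: "'a measure"
    and N :: nat
    and \<phi> :: "nat \<Rightarrow> 'a \<Rightarrow> real"
    and M :: "nat \<Rightarrow> real"
    and q :: "'a \<Rightarrow> 'a \<Rightarrow> real"
    and l L :: real
  assumes "N \<ge> 1"
    and "\<And>i. i \<in> {1..N} \<Longrightarrow> \<phi> i \<in> borel_measurable \<mu>"
    and "\<And>i. i \<in> {1..N} \<Longrightarrow> M i > 0"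
    and "\<And>i \<theta>. i \<in> {1..N} \<Longrightarrow> \<theta> \<in> space \<mu> \<Longrightarrow> \<phi> i \<theta> \<in> {0..M i}"
    and "prob_space (target \<mu> N \<phi>)"
    and "(\<lambda>(\<theta>, \<theta>'). q \<theta> \<theta>') \<in> borel_measurable (\<mu> \<Otimes>\<^sub>M \<mu>)"
    and "\<And>\<theta> \<theta>'. \<theta> \<in> space \<mu> \<Longrightarrow> \<theta>' \<in> space \<mu> \<Longrightarrow> q \<theta> \<theta>' \<ge> 0"
    and "\<And>\<theta>. \<theta> \<in> space \<mu> \<Longrightarrow> (\<integral>\<^sup>+\<theta>'. ennreal (q \<theta> \<theta>') \<partial>\<mu>) = 1"
    and "l > 0"
    and "L = (\<Sum>i=1..N. M i)"
  shows "spectral_gap (target \<mu> N \<phi>) (poisson_mh_kernel \<mu> q N \<phi> M L l)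
    \<ge> max (1 / 2 * exp (- (L\<^sup>2 / (l + L)))) (exp (- (1 / exp 1)) * exp (- (L\<^sup>2 / (2 * l))))
      * spectral_gap (target \<mu> N \<phi>) (mh_kernel \<mu> q (target_density \<mu> N \<phi>))"
proof -
  note phi_measurable[measurable] = assms(2) and q_measurable[measurable] = assms(6)
  have L: "L > 0" unfolding assms(10) using assms(1,3) by (intro sum_pos) auto
  define p where "p = target_density \<mu> N \<phi>"
  define Z where "Z = (\<integral>x. exp (\<Sum>i=1..N. \<phi> i x) \<partial>\<mu>)"
  have p_eq: "p x = exp (\<Sum>i=1..N. \<phi> i x) / Z" for x by (simp add: p_def target_density_def Z_def)
  have prob: "prob_space (density \<mu> (\<lambda>x. ennreal (p x)))"
    using assms(5) by (simp add: target_def p_def)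
  have phi_nonneg: "\<phi> i x \<ge> 0" if "i \<in> {1..N}" "x \<in> space \<mu>" for i x
    using assms(4)[OF that] by simp
  have expm: "(\<lambda>x. exp (\<Sum>i=1..N. \<phi> i x)) \<in> borel_measurable \<mu>" by measurable
  \<comment> \<open>Sigma-finiteness of the base measure is derived: the \<open>\<phi> i\<close> are
    nonnegative, so the unnormalised density is at least 1.\<close>
  have Z: "Z > 0" and sf: "sigma_finite_measure \<mu>"
  proof -
    have one: "1 \<le> exp (\<Sum>i=1..N. \<phi> i x)" if "x \<in> space \<mu>" for x
      using phi_nonneg that by (subst one_le_exp_iff) (auto intro!: sum_nonneg)
    show "Z > 0" "sigma_finite_measure \<mu>"
      using normalized_density_base[OF prob[unfolded p_eq Z_def] expm one] by (simp_all add: Z_def)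
  qed
  have p_pos: "p x > 0" for x using Z by (simp add: p_eq)
  have p_measurable[measurable]: "p \<in> borel_measurable \<mu>" unfolding p_eq[abs_def] using expm by measurable

  \<comment> \<open>The two coins are spelled as in the kernel definitions, so that unfolding alone
    gives the final statement.\<close>
  define acc where "acc x y = bernoulli_pmf (min 1 ((p y * q y x) / (p x * q x y)))" for x y
  define acc' where "acc' x y = bind_pmf (Pi_pmf {1..N} 0 (\<lambda>i. poisson_pmf (l * M i / L + \<phi> i x)))
        (\<lambda>s. bernoulli_pmf (min 1 (poisson_mh_ratio q N \<phi> M L l x y s)))" for x y
  define a where "a x i = l * M i / L + \<phi> i x" for x i
  have a_measurable[measurable]: "(\<lambda>x. a x i) \<in> borel_measurable \<mu>" if "i \<in> {1..N}" for i
    unfolding a_def using phi_measurable[OF that] by measurable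
  define D where "D x = poisson_product {1..N} (a x)" for x
  define g where "g x y = poisson_loglik {1..N} (a x) (a y)" for x y
  define c where "c = max (1 / 2 * exp (- (L\<^sup>2 / (l + L)))) (exp (- (1 / exp 1)) * exp (- (L\<^sup>2 / (2 * l))))"
  have a_bounds: "a x i \<in> {l * M i / L..l * M i / L + M i}" "a x i > 0" if "i \<in> {1..N}" "x \<in> space \<mu>" for x i
    using assms(3)[OF that(1)] assms(4)[OF that] assms(9) L by (auto simp: a_def intro!: add_pos_nonneg)
  have likelihood: "pmf (D y) s = pmf (D x) s * exp (g x y s)" if "x \<in> space \<mu>" "y \<in> space \<mu>" for x y s
    unfolding D_def g_def using a_bounds(2) that by (intro pmf_poisson_product) auto
  have overlap: "c \<le> measure_pmf.expectation (D x) (\<lambda>s. min 1 (exp (g x y s)))"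
    if "x \<in> space \<mu>" "y \<in> space \<mu>" for x y
    unfolding c_def D_def g_def using a_bounds that assms
    by (intro poisson_overlap_bound[where M = M]) auto

  have q_nonneg: "q x y \<ge> 0" if "x \<in> space \<mu>" "y \<in> space \<mu>" for x y using assms(7)[OF that] .
  have acc: "pmf (acc x y) True = min 1 ((p y * q y x) / (p x * q x y))"
    if "x \<in> space \<mu>" "y \<in> space \<mu>" for x y
    using p_pos[of x] p_pos[of y] q_nonneg[OF that] q_nonneg[OF that(2,1)]
    unfolding acc_def by (intro pmf_bernoulli_True) auto
  have acc': "pmf (acc' x y) True
      = measure_pmf.expectation (D x) (\<lambda>s. min 1 (exp (g x y s) * ((p y * q y x) / (p x * q x y))))"
    if "x \<in> space \<mu>" "y \<in> space \<mu>" for x y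
  proof -
    have "poisson_mh_ratio q N \<phi> M L l x y s = exp (g x y s) * ((p y * q y x) / (p x * q x y))" for s
      unfolding g_def a_def p_def
      using assms(3,9) L phi_nonneg that Z unfolding Z_def by (intro poisson_mh_ratio_eq) auto
    moreover have "0 \<le> exp (g x y s) * ((p y * q y x) / (p x * q x y))" for s
      using p_pos[of x] p_pos[of y] q_nonneg[OF that] q_nonneg[OF that(2,1)] by simp
    ultimately show ?thesis
      unfolding acc'_def pmf_bind D_def a_def by simp
  qed
  \<comment> \<open>The auxiliary flow from \<open>x\<close> to \<open>y\<close>, in a form
    invariant under exchanging the two states.\<close>
  define I where "I x y = (\<integral>s. min ((p x * q x y) * pmf (D x) s) ((p y * q y x) * pmf (D y) s) \<partial>count_space UNIV)" for x y
  have flow': "p x * q x y * pmf (acc' x y) True = I x y" if "x \<in> space \<mu>" "y \<in> space \<mu>" for x y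
    unfolding acc'[OF that] I_def
    using p_pos[of x] p_pos[of y] q_nonneg[OF that] q_nonneg[OF that(2,1)]
    by (intro expectation_min_symmetric likelihood that) auto
  have flow: "p x * q x y * pmf (acc x y) True = min (p x * q x y) (p y * q y x)"
    if "x \<in> space \<mu>" "y \<in> space \<mu>" for x y
  \<comment> \<open>If \<open>q x y = 0\<close> both sides are 0, whatever the ratio evaluates
    to.\<close>
  proof (cases "q x y = 0")
    case False
    then have "0 < p x * q x y" using p_pos[of x] q_nonneg[OF that] by (simp add: less_le)
    then show ?thesis unfolding acc[OF that] by (auto simp: min_def field_simps)
  next
    case True
    then show ?thesis using p_pos[of y] q_nonneg[OF that(2,1)] by simp
  qed

  have q_swap[measurable]: "(\<lambda>(x, y). q y x) \<in> borel_measurable (\<mu> \<Otimes>\<^sub>M \<mu>)" by measurable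
  have acc_measurable: "(\<lambda>(x, y). pmf (acc x y) True) \<in> borel_measurable (\<mu> \<Otimes>\<^sub>M \<mu>)"
  proof (subst measurable_cong)
    show "(case z of (x, y) \<Rightarrow> pmf (acc x y) True) = (case z of (x, y) \<Rightarrow> min 1 ((p y * q y x) / (p x * q x y)))"
      if "z \<in> space (\<mu> \<Otimes>\<^sub>M \<mu>)" for z
      using that by (auto simp: space_pair_measure acc)
  qed measurable
  have acc'_measurable: "(\<lambda>(x, y). pmf (acc' x y) True) \<in> borel_measurable (\<mu> \<Otimes>\<^sub>M \<mu>)"
  proof (subst measurable_cong)
    show "(case z of (x, y) \<Rightarrow> pmf (acc' x y) True) = (\<integral>s. (case z of (x, y) \<Rightarrow>
        pmf (D x) s * min 1 (exp (g x y s) * ((p y * q y x) / (p x * q x y)))) \<partial>count_space UNIV)"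
      if "z \<in> space (\<mu> \<Otimes>\<^sub>M \<mu>)" for z
      using that by (auto simp: space_pair_measure acc' expectation_pmf_count_space)
    \<comment> \<open>All laws \<open>D x\<close> are carried by this one set, whatever the
      state.\<close>
    define S where "S = {s :: nat \<Rightarrow> nat. \<forall>i. i \<notin> {1..N} \<longrightarrow> s i = 0}"
    show "(\<lambda>z. \<integral>s. (case z of (x, y) \<Rightarrow>
        pmf (D x) s * min 1 (exp (g x y s) * ((p y * q y x) / (p x * q x y)))) \<partial>count_space UNIV)
        \<in> borel_measurable (\<mu> \<Otimes>\<^sub>M \<mu>)"
    proof (rule borel_measurable_integral_count_space)
      \<comment> \<open>The rates 1 are an arbitrary positive choice: such a product has support
        exactly \<open>S\<close>, and supports are countable.\<close>
      have "set_pmf (poisson_product {1..N} (\<lambda>_. 1)) = S"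
        by (subst set_Pi_pmf) (auto simp: S_def PiE_dflt_def)
      then show "countable S" by (metis countable_set_pmf)
      show "(case z of (x, y) \<Rightarrow> pmf (D x) s * min 1 (exp (g x y s) * ((p y * q y x) / (p x * q x y)))) = 0"
        if "s \<notin> S" for z s
        using that by (auto simp: S_def D_def pmf_Pi split: prod.splits)
      fix s assume s: "s \<in> S"
      \<comment> \<open>Unfolding the mass function exposes its dependence on \<open>x\<close>
        through the rates, which are measurable.\<close>
      have "pmf (D x) s = (\<Prod>i=1..N. a x i ^ s i / fact (s i) * exp (- a x i))" if "x \<in> space \<mu>" for x
      proof -
        have "pmf (D x) s = (\<Prod>i=1..N. pmf (poisson_pmf (a x i)) (s i))"
          using s by (auto simp: D_def pmf_Pi S_def)
        also have "\<dots> = (\<Prod>i=1..N. a x i ^ s i / fact (s i) * exp (- a x i))"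
          using a_bounds(2) that by (intro prod.cong refl pmf_poisson) auto
        finally show ?thesis .
      qed
      moreover have [measurable]: "(\<lambda>x. \<Prod>i=1..N. a x i ^ s i / fact (s i) * exp (- a x i)) \<in> borel_measurable \<mu>"
        by measurable
      ultimately have [measurable]: "(\<lambda>x. pmf (D x) s) \<in> borel_measurable \<mu>"
        by (simp cong: measurable_cong)
      have [measurable]: "(\<lambda>(x, y). g x y s) \<in> borel_measurable (\<mu> \<Otimes>\<^sub>M \<mu>)"
        unfolding g_def poisson_loglik_def by measurable
      show "(\<lambda>z. case z of (x, y) \<Rightarrow>
          pmf (D x) s * min 1 (exp (g x y s) * ((p y * q y x) / (p x * q x y)))) \<in> borel_measurable (\<mu> \<Otimes>\<^sub>M \<mu>)"
        by measurable
    qed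
  qed

  have ideal: "accept_kernel \<mu> p q acc"
  proof (rule accept_kernel.intro[OF sf p_measurable p_pos prob assms(6) assms(7) assms(8) acc_measurable])
    show "p x * q x y * pmf (acc x y) True = p y * q y x * pmf (acc y x) True"
      if "x \<in> space \<mu>" "y \<in> space \<mu>" for x y
      using flow[OF that] flow[OF that(2,1)] by (simp add: min.commute)
  qed
  have aux: "accept_kernel \<mu> p q acc'"
  proof (rule accept_kernel.intro[OF sf p_measurable p_pos prob assms(6) assms(7) assms(8) acc'_measurable])
    show "p x * q x y * pmf (acc' x y) True = p y * q y x * pmf (acc' y x) True"
      if "x \<in> space \<mu>" "y \<in> space \<mu>" for x y
      using flow'[OF that] flow'[OF that(2,1)] by (simp add: I_def min.commute)
  qed

  have exp_le: "exp (- v) \<le> 1" if "v \<ge> 0" for v :: real using that by simp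
  have c: "0 \<le> c"
    unfolding c_def by (rule max.coboundedI1) simp
  have "1 / 2 * exp (- (L\<^sup>2 / (l + L))) \<le> 1 * 1"
    using L assms(9) by (intro mult_mono exp_le) auto
  moreover have "exp (- (1 / exp 1)) * exp (- (L\<^sup>2 / (2 * l))) \<le> 1 * 1"
    using L assms(9) by (intro mult_mono exp_le) auto
  ultimately have "c \<le> 1" unfolding c_def by simp
  have "c * spectral_gap (density \<mu> p) (propose_accept \<mu> q acc) \<le> spectral_gap (density \<mu> p) (propose_accept \<mu> q acc')"
  proof (rule spectral_gap_comparison[OF ideal aux c \<open>c \<le> 1\<close>])
    fix x y assume xy: "x \<in> space \<mu>" "y \<in> space \<mu>" and "q x y > 0"
    define \<alpha> \<beta> where "\<alpha> = p x * q x y" and "\<beta> = p y * q y x"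
    have \<alpha>: "\<alpha> > 0" and \<beta>: "\<beta> \<ge> 0"
      using \<open>q x y > 0\<close> p_pos[of x] p_pos[of y] q_nonneg[OF xy(2,1)] by (auto simp: \<alpha>_def \<beta>_def)
    \<comment> \<open>The symmetric form with both weights 1 turns the expected minimum into an
      integral of the smaller mass function.\<close>
    have ov: "c \<le> (\<integral>s. min (pmf (D x) s) (pmf (D y) s) \<partial>count_space UNIV)"
      using overlap[OF xy] expectation_min_symmetric[of "D y" "D x" "g x y" 1 1] likelihood[OF xy] by simp
    have I: "I x y = (\<integral>s. min (\<alpha> * pmf (D x) s) (\<beta> * pmf (D y) s) \<partial>count_space UNIV)"
      by (simp add: I_def \<alpha>_def \<beta>_def)
    have "I x y \<le> min \<alpha> \<beta>"
      unfolding I using \<alpha> \<beta> by (intro integral_min_pmf_bounds) auto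
    moreover have "min \<alpha> \<beta> * c \<le> I x y"
    proof -
      have "min \<alpha> \<beta> * c \<le> min \<alpha> \<beta> * (\<integral>s. min (pmf (D x) s) (pmf (D y) s) \<partial>count_space UNIV)"
        using \<alpha> \<beta> ov by (intro mult_left_mono) auto
      also have "\<dots> \<le> I x y" unfolding I using \<alpha> \<beta> by (intro integral_min_pmf_bounds) auto
      finally show ?thesis .
    qed
    \<comment> \<open>Both flow bounds, with the common factor \<open>\<alpha>\<close> isolated; it
      is positive because \<open>q x y > 0\<close> and is then cancelled.\<close>
    ultimately have "\<alpha> * (c * pmf (acc x y) True) \<le> \<alpha> * pmf (acc' x y) True
        \<and> \<alpha> * pmf (acc' x y) True \<le> \<alpha> * pmf (acc x y) True"
      using flow[OF xy] flow'[OF xy] unfolding \<alpha>_def[symmetric] \<beta>_def[symmetric]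
      unfolding mult.left_commute[of \<alpha> c] by (simp only: mult.commute[of c])
    then show "c * pmf (acc x y) True \<le> pmf (acc' x y) True \<and> pmf (acc' x y) True \<le> pmf (acc x y) True"
      using \<alpha> by simp
  qed
  then show ?thesis
    unfolding c_def target_def p_def[symmetric] mh_kernel_def poisson_mh_kernel_def
      acc_def[abs_def] acc'_def[abs_def] .
qed

end
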